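(* Let $G\subset\mathbb{R}^n$ be a neighborhood of the origin and let $\frac{d\mathbf{x}}{dt}=\mathbf{f}(\mathbf{x})$ be an autonomous system of ordinary differential equations given in $G$, for which the origin $\mathbf{0}$ is an isolated equilibrium. Suppose that in $G$ there is a convergent sequence of hypersurfaces $\mathbf{H}_i^{n-1}$ ($i=1,2,\dots$), with associated compact sets $\mathbf{K}_i$, which is different, i.e. for every natural number $m$ there are natural numbers $k>l>m$ such that $\mathbf{H}_k^{n-1}$ and $\mathbf{H}_l^{n-1}$ are not homeomorphic. For each $i$ let $\vec N$ be the unit normal vector field on $\mathbf{H}_i^{n-1}$ directed to the inside of $\mathbf{K}_i$. If for every $i$ and every $\mathbf{x}\in\mathbf{H}_i^{n-1}$ one has $S(\mathbf{x})=\langle \vec N(\mathbf{x}),\mathbf{f}(\mathbf{x})\rangle>0$, then the equilibrium $\mathbf{0}$ of the system is stable but not asymptotically stable in the sense of Lyapunov.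
   Context: A compact connected smooth $(n-1)$-dimensional submanifold $\mathbf{H}^{n-1}$ of $\mathbb{R}^n$ lying in $G$ is said to restrict the origin if $\mathbf{0}\notin\mathbf{H}^{n-1}$ and $\mathbf{H}^{n-1}$ is the boundary of a compact set $\mathbf{K}$ containing the origin. A sequence $\mathbf{H}_i^{n-1}$ ($i=1,2,\dots$) of hypersurfaces restricting the origin is a convergent sequence of hypersurfaces if the $\mathbf{H}_i^{n-1}$ are pairwise disjoint and there are compact sets $\mathbf{K}_i$ containing the origin with boundary $\mathbf{H}_i^{n-1}$ such that $\bigcap_i\mathbf{K}_i=\{\mathbf{0}\}$ and $\mathbf{K}_i\supset\mathbf{K}_j$ for $i<j$. Here $\langle\cdot,\cdot\rangle$ is the Euclidean inner product. The map $\mathbf{f}:G\to\mathbb{R}^n$ is continuous and through every point of $G$ there passes a unique phase curve (solution) of the system. An equilibrium is a zero of $\mathbf{f}$; it is isolated if it has a neighborhood containing no other zero of $\mathbf{f}$. *)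

theory Defs
  imports "HOL-Analysis.Analysis"
begin

section \<open>Smooth submanifolds of Euclidean space\<close>

text \<open>Differentiability of class \<open>C\<^sup>k\<close> on an open set, by iterated directional derivatives.
  Only meaningful for open \<open>U\<close>.\<close>

primrec Ck_on :: "nat \<Rightarrow> 'a::euclidean_space set \<Rightarrow> ('a \<Rightarrow> 'b::euclidean_space) \<Rightarrow> bool" where
  "Ck_on 0 U g \<longleftrightarrow> continuous_on U g"
| "Ck_on (Suc k) U g \<longleftrightarrow>
     (\<forall>x\<in>U. g differentiable (at x)) \<and>
     (\<forall>v. Ck_on k U (\<lambda>x. frechet_derivative g (at x) v))"

definition smooth_on :: "'a::euclidean_space set \<Rightarrow> ('a \<Rightarrow> 'b::euclidean_space) \<Rightarrow> bool" where
  "smooth_on U g \<longleftrightarrow> (\<forall>k. Ck_on k U g)"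

definition smooth_submanifold :: "nat \<Rightarrow> 'a::euclidean_space set \<Rightarrow> bool" where
  "smooth_submanifold d M \<longleftrightarrow>
     (\<forall>p\<in>M. \<exists>U V \<phi> \<psi> L.
        open U \<and> p \<in> U \<and> open V \<and>
        homeomorphism U V \<phi> \<psi> \<and> smooth_on U \<phi> \<and> smooth_on V \<psi> \<and>
        subspace L \<and> dim L = d \<and> \<phi> ` (U \<inter> M) = V \<inter> (L :: 'a set))"

text \<open>The tangent space as the set of velocities of curves in \<open>M\<close>; on a smooth submanifold,
  differentiability of the curve at the base point suffices.\<close>

definition tangent_space :: "'a::euclidean_space set \<Rightarrow> 'a \<Rightarrow> 'a set" where
  "tangent_space M p =
     {v. \<exists>\<gamma> e. e > 0 \<and> (\<forall>t. \<bar>t\<bar> < e \<longrightarrow> \<gamma> t \<in> M) \<and> \<gamma> 0 = p \<and>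
           (\<gamma> has_vector_derivative v) (at (0::real))}"

definition inward_unit_normal :: "'a::euclidean_space set \<Rightarrow> 'a set \<Rightarrow> 'a \<Rightarrow> 'a \<Rightarrow> bool" where
  "inward_unit_normal H K p \<nu> \<longleftrightarrow>
     norm \<nu> = 1 \<and> (\<forall>v\<in>tangent_space H p. \<nu> \<bullet> v = 0) \<and>
     (\<exists>e>0. \<forall>t. 0 < t \<and> t < e \<longrightarrow> p + t *\<^sub>R \<nu> \<in> interior K)"

section \<open>Hypersurfaces restricting the origin\<close>

definition bounds_around_origin :: "'a::euclidean_space set \<Rightarrow> 'a set \<Rightarrow> bool" where
  "bounds_around_origin H K \<longleftrightarrow> compact K \<and> 0 \<in> K \<and> frontier K = H"

definition restricts_origin :: "'a::euclidean_space set \<Rightarrow> 'a set \<Rightarrow> bool" where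
  "restricts_origin G H \<longleftrightarrow>
     compact H \<and> connected H \<and> smooth_submanifold (DIM('a) - 1) H \<and> H \<subseteq> G \<and>
     0 \<notin> H \<and> (\<exists>K. bounds_around_origin H K)"

text \<open>The compact sets \<open>K i\<close> are an argument, since the inward normals refer to them. They need
  not lie in \<open>G\<close>.\<close>

definition convergent_hypersurfaces ::
    "'a::euclidean_space set \<Rightarrow> (nat \<Rightarrow> 'a set) \<Rightarrow> (nat \<Rightarrow> 'a set) \<Rightarrow> bool" where
  "convergent_hypersurfaces G H K \<longleftrightarrow>
     (\<forall>i. restricts_origin G (H i)) \<and>
     (\<forall>i j. i \<noteq> j \<longrightarrow> H i \<inter> H j = {}) \<and>
     (\<forall>i. bounds_around_origin (H i) (K i)) \<and>
     (\<Inter>i. K i) = {0} \<and>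
     (\<forall>i j. i < j \<longrightarrow> K j \<subseteq> K i)"

definition different_hypersurfaces :: "(nat \<Rightarrow> 'a::euclidean_space set) \<Rightarrow> bool" where
  "different_hypersurfaces H \<longleftrightarrow>
     (\<forall>m. \<exists>k l. k > l \<and> l > m \<and> \<not> (H k) homeomorphic (H l))"

section \<open>Autonomous systems and Lyapunov stability\<close>

text \<open>\<open>x\<close> is a solution of \<open>x' = f x\<close> in \<open>G\<close> on the open interval \<open>J\<close>, which contains
  the initial time \<open>0\<close>, with initial value \<open>p\<close>. Nothing is assumed about \<open>x\<close> outside \<open>J\<close>.\<close>

definition solution_through ::
    "'a::euclidean_space set \<Rightarrow> ('a \<Rightarrow> 'a) \<Rightarrow> 'a \<Rightarrow> real set \<Rightarrow> (real \<Rightarrow> 'a) \<Rightarrow> bool" where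
  "solution_through G f p J x \<longleftrightarrow>
     open J \<and> is_interval J \<and> 0 \<in> J \<and> x 0 = p \<and>
     (\<forall>t\<in>J. x t \<in> G \<and> (x has_vector_derivative f (x t)) (at t))"

definition unique_solutions :: "'a::euclidean_space set \<Rightarrow> ('a \<Rightarrow> 'a) \<Rightarrow> bool" where
  "unique_solutions G f \<longleftrightarrow>
     (\<forall>p\<in>G. (\<exists>J x. solution_through G f p J x) \<and>
        (\<forall>J x J' x'. solution_through G f p J x \<and> solution_through G f p J' x' \<longrightarrow>
           (\<forall>t\<in>J \<inter> J'. x t = x' t)))"

definition isolated_equilibrium :: "'a::euclidean_space set \<Rightarrow> ('a \<Rightarrow> 'a) \<Rightarrow> 'a \<Rightarrow> bool" where
  "isolated_equilibrium G f p \<longleftrightarrow>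
     p \<in> G \<and> f p = 0 \<and> (\<exists>U. open U \<and> p \<in> U \<and> (\<forall>x\<in>U \<inter> G. f x = 0 \<longrightarrow> x = p))"

definition lyapunov_stable :: "'a::euclidean_space set \<Rightarrow> ('a \<Rightarrow> 'a) \<Rightarrow> 'a \<Rightarrow> bool" where
  "lyapunov_stable G f p \<longleftrightarrow>
     (\<forall>\<epsilon>>0. \<exists>\<delta>>0. \<forall>q\<in>G. dist q p < \<delta> \<longrightarrow>
        (\<exists>J x. solution_through G f q J x \<and> {0..} \<subseteq> J) \<and>
        (\<forall>J x. solution_through G f q J x \<longrightarrow> (\<forall>t\<in>J. 0 \<le> t \<longrightarrow> dist (x t) p < \<epsilon>)))"

definition attractive :: "'a::euclidean_space set \<Rightarrow> ('a \<Rightarrow> 'a) \<Rightarrow> 'a \<Rightarrow> bool" where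
  "attractive G f p \<longleftrightarrow>
     (\<exists>\<delta>>0. \<forall>q\<in>G. dist q p < \<delta> \<longrightarrow>
        (\<exists>J x. solution_through G f q J x \<and> {0..} \<subseteq> J) \<and>
        (\<forall>J x. solution_through G f q J x \<and> {0..} \<subseteq> J \<longrightarrow> (x \<longlongrightarrow> p) at_top))"

definition asymptotically_stable :: "'a::euclidean_space set \<Rightarrow> ('a \<Rightarrow> 'a) \<Rightarrow> 'a \<Rightarrow> bool" where
  "asymptotically_stable G f p \<longleftrightarrow> lyapunov_stable G f p \<and> attractive G f p"

end

theory Submission
  imports Defs "HOL-Complex_Analysis.Great_Picard"
begin

text \<open>The sign condition makes each \<open>K i\<close> inside \<open>G\<close> a trap: a solution that
  meets \<open>H i\<close> lies outside \<open>K i\<close> just before and in the interior of \<open>K i\<close> just after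
  (\<open>crosses_inward\<close>). Hence a solution starting in \<open>K i\<close> can never leave it, and since it stays in a
  compact subset of \<open>G\<close>, it exists for all positive times (\<open>global_solution\<close>). As the \<open>K i\<close> are
  neighbourhoods of the origin that shrink to it, the origin is stable.

  Suppose that the origin were attractive. Choose \<open>l < k\<close> with \<open>K l\<close> inside the region of attraction and
  \<open>H l\<close> not homeomorphic to \<open>H k\<close>. Every solution starting on \<open>H l\<close> ends up in the interior of \<open>K k\<close>,
  so it crosses \<open>H k\<close>, and only once, because it is trapped afterwards. The map that sends a point of
  \<open>H l\<close> to this crossing point is a homeomorphism from \<open>H l\<close> onto \<open>H k\<close>
  (\<open>frontier_homeomorphic\<close>), a contradiction. It is injective because two solutions that meet coincide
  and a solution visits \<open>H l\<close> at most once. It is onto because a solution followed backwards from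
  \<open>H k\<close> cannot stay in \<open>K l\<close> for arbitrarily long times, by compactness of \<open>K l\<close>, and
  can leave it only through \<open>H l\<close>.

  The field \<open>f\<close> is only continuous, so continuous dependence of solutions on the initial value does
  not come from a Lipschitz condition. It follows from uniqueness: by the Arzela-Ascoli theorem, every
  sequence of solutions in a compact set has a subsequence that converges uniformly to a solution, and
  there is only one candidate for this limit (\<open>solutions_compact\<close>, \<open>continuous_on_flow\<close>).\<close>

section \<open>Crossing a hypersurface in the inward direction\<close>

lemma subset_interior_or_disjoint_if_connected:
  assumes "connected S" "S \<inter> frontier K = {}" "closed K"
  shows "S \<subseteq> interior K \<or> S \<inter> K = {}"
proof (rule disjCI)
  assume "S \<inter> K \<noteq> {}"
  with connected_Int_frontier[OF assms(1), of K] assms(2) have "S \<subseteq> K"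
    by blast
  with assms(2,3) show "S \<subseteq> interior K"
    by (auto simp: frontier_def)
qed

lemma subspace_codim_1_normal:
  fixes L :: "'a::euclidean_space set"
  assumes "subspace L" "dim L = DIM('a) - 1"
  obtains a where "L = {y. a \<bullet> y = 0}"
proof -
  have "dim L < DIM('a)"
    using assms(2) DIM_positive[where 'a='a] by linarith
  then obtain a where a: "a \<noteq> 0" "span L \<subseteq> {x. a \<bullet> x = 0}"
    using lowdim_subset_hyperplane by blast
  have "L = {x. a \<bullet> x = 0}"
    using a assms by (intro subspace_dim_equal) (auto simp: subspace_hyperplane span_superset dim_hyperplane
      intro: span_base)
  then show thesis by (rule that)
qed

text \<open>In a chart that flattens \<open>H\<close> to the hyperplane \<open>a \<bullet> y = 0\<close>, the function
  \<open>a \<bullet> \<phi> x\<close> has \<open>H\<close> as its zero set near \<open>p\<close>. The gradient of this function is normal to \<open>H\<close>, hence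
  proportional to \<open>\<nu>\<close>, and after rescaling equal to \<open>\<nu>\<close>. Each of its two sides is connected and
  disjoint from the frontier of \<open>K\<close>, so it lies wholly inside or wholly outside \<open>K\<close>; the ray in
  direction \<open>\<nu>\<close> shows that the positive side is inside.\<close>

lemma inward_defining_function:
  fixes H K :: "'a::euclidean_space set"
  assumes sub: "smooth_submanifold (DIM('a) - 1) H"
    and K: "closed K" "frontier K = H"
    and p: "p \<in> H"
    and nu: "inward_unit_normal H K p \<nu>"
  obtains W h where "open W" "p \<in> W" "h p = 0" "(h has_derivative (\<lambda>v. \<nu> \<bullet> v)) (at p)"
    "\<And>x. x \<in> W \<Longrightarrow> 0 < h x \<Longrightarrow> x \<in> interior K"
    "\<And>x. x \<in> W \<Longrightarrow> h x < 0 \<Longrightarrow> x \<notin> K"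
proof -
  obtain U V \<phi> \<psi> L where UV: "open U" "p \<in> U" "open V" "homeomorphism U V \<phi> \<psi>"
      and sm: "smooth_on U \<phi>" "smooth_on V \<psi>"
      and L: "subspace (L :: 'a set)" "dim L = DIM('a) - 1" and flat: "\<phi> ` (U \<inter> H) = V \<inter> L"
    using bspec[OF sub[unfolded smooth_submanifold_def] p]
    by (elim exE conjE) (rule that; assumption)
  obtain a where La: "L = {y. a \<bullet> y = 0}"
    using subspace_codim_1_normal[OF L] by blast
  have inv: "\<And>x. x \<in> U \<Longrightarrow> \<psi> (\<phi> x) = x" "\<And>y. y \<in> V \<Longrightarrow> \<phi> (\<psi> y) = y"
      "\<And>x. x \<in> U \<Longrightarrow> \<phi> x \<in> V" "\<And>y. y \<in> V \<Longrightarrow> \<psi> y \<in> U"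
      and cont: "continuous_on U \<phi>" "continuous_on V \<psi>"
    using UV(4) unfolding homeomorphism_def by auto
  have "Ck_on 1 U \<phi>" "Ck_on 1 V \<psi>"
    using sm unfolding smooth_on_def by blast+
  then obtain D E where D: "(\<phi> has_derivative D) (at p)" and E: "(\<psi> has_derivative E) (at (\<phi> p))"
    using UV(2) inv(3)[OF UV(2)] unfolding One_nat_def Ck_on.simps differentiable_def by blast
  have DE: "E (D v) = v" for v
  proof -
    have "((\<lambda>x. x) has_derivative (\<lambda>v. E (D v))) (at p)"
      using has_derivative_transform_within_open
        [OF has_derivative_compose[OF D E] UV(1,2), of "\<lambda>x. x"] inv(1) by simp
    then have "(\<lambda>v. E (D v)) = (\<lambda>x. x)"
      by (rule has_derivative_unique[OF _ has_derivative_ident])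
    then show ?thesis by meson
  qed
  have linD: "linear D" and linE: "linear E"
    using D E has_derivative_linear by blast+
  have on_H: "\<psi> y \<in> H \<longleftrightarrow> a \<bullet> y = 0" if "y \<in> V" for y
  proof
    assume "\<psi> y \<in> H"
    then have "\<phi> (\<psi> y) \<in> V \<inter> L"
      using flat inv(4)[OF that] by blast
    then show "a \<bullet> y = 0"
      using inv(2)[OF that] La by simp
  next
    assume "a \<bullet> y = 0"
    then have "y \<in> \<phi> ` (U \<inter> H)"
      using that La flat by simp
    then obtain x where "x \<in> U \<inter> H" "\<phi> x = y"
      by blast
    then show "\<psi> y \<in> H"
      using inv(1) by auto
  qed
  have flat_p: "a \<bullet> \<phi> p = 0"
    using on_H[OF inv(3)[OF UV(2)]] inv(1)[OF UV(2)] p by simp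
  \<comment> \<open>The straight lines in the chart give enough curves in \<open>H\<close> to see that the kernel of the
    derivative of \<open>a \<bullet> \<phi>\<close> consists of tangent vectors.\<close>
  have tangent: "v \<in> tangent_space H p" if "a \<bullet> D v = 0" for v
  proof -
    define \<gamma> where "\<gamma> t = \<psi> (\<phi> p + t *\<^sub>R D v)" for t :: real
    have "((\<lambda>t. \<phi> p + t *\<^sub>R D v) has_vector_derivative D v) (at 0)"
      by (auto intro!: derivative_eq_intros)
    moreover have "(\<psi> has_derivative E) (at (\<phi> p + 0 *\<^sub>R D v))"
      using E by simp
    ultimately have "(\<gamma> has_vector_derivative v) (at 0)"
      unfolding has_vector_derivative_def \<gamma>_def
      by (rule has_derivative_eq_rhs[OF has_derivative_compose])
         (simp add: linear_cmul[OF linE] DE)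
    moreover obtain e where e: "e > 0" "\<forall>t. \<bar>t\<bar> < e \<longrightarrow> \<phi> p + t *\<^sub>R D v \<in> V"
    proof -
      have "isCont (\<lambda>t::real. \<phi> p + t *\<^sub>R D v) 0"
        by (intro continuous_intros)
      then have "\<forall>\<^sub>F t in nhds 0. \<phi> p + t *\<^sub>R D v \<in> V"
        using UV(3) inv(3)[OF UV(2)]
        by (auto simp: continuous_at_open eventually_nhds)
      then show thesis
        using that by (auto simp: eventually_nhds_metric)
    qed
    moreover have "\<gamma> t \<in> H" if "\<bar>t\<bar> < e" for t
      using e(2) that on_H \<open>a \<bullet> D v = 0\<close> flat_p by (simp add: \<gamma>_def inner_add_right)
    ultimately show ?thesis
      unfolding tangent_space_def using inv(1)[OF UV(2)] by (auto simp: \<gamma>_def intro!: exI[of _ \<gamma>])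
  qed
  have nu1: "norm \<nu> = 1" and orth: "\<And>v. a \<bullet> D v = 0 \<Longrightarrow> \<nu> \<bullet> v = 0"
    using nu tangent unfolding inward_unit_normal_def by blast+
  \<comment> \<open>So \<open>\<nu>\<close> is a multiple \<open>s\<close> of the gradient \<open>b\<close>; the factor is used to rescale the
    defining function, whatever its sign.\<close>
  define b where "b = adjoint D a"
  have b: "a \<bullet> D v = b \<bullet> v" for v
    using adjoint_works[OF linD, of v a] by (simp add: b_def inner_commute)
  have "b \<noteq> 0"
    using orth[of \<nu>] nu1 b[of \<nu>] by auto
  define s where "s = (\<nu> \<bullet> b) / (b \<bullet> b)"
  have s: "\<nu> = s *\<^sub>R b"
  proof -
    have bw: "b \<bullet> (\<nu> - s *\<^sub>R b) = 0"
      using \<open>b \<noteq> 0\<close> by (simp add: s_def inner_diff_right inner_commute)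
    then have "\<nu> \<bullet> (\<nu> - s *\<^sub>R b) = 0"
      using orth b by simp
    with bw have "(\<nu> - s *\<^sub>R b) \<bullet> (\<nu> - s *\<^sub>R b) = 0"
      by (simp add: inner_diff_left)
    then show ?thesis by simp
  qed
  then have "s \<noteq> 0"
    using nu1 by auto
  define h where "h x = s * (a \<bullet> \<phi> x)" for x
  have h_deriv: "(h has_derivative (\<lambda>v. \<nu> \<bullet> v)) (at p)"
    unfolding h_def
    by (rule has_derivative_eq_rhs[OF has_derivative_mult_right[OF has_derivative_inner_right[OF D]]])
       (simp add: fun_eq_iff b s)
  have h_p: "h p = 0"
    by (simp add: h_def flat_p)
  obtain r where r: "r > 0" "ball (\<phi> p) r \<subseteq> V"
    using UV(3) inv(3)[OF UV(2)] open_contains_ball by blast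
  define W where "W = U \<inter> \<phi> -` ball (\<phi> p) r"
  have W: "open W" "p \<in> W"
    using continuous_open_preimage[OF cont(1) UV(1)] r UV(2) by (auto simp: W_def)
  have W_H: "x \<in> H \<longleftrightarrow> h x = 0" if "x \<in> W" for x
    using that on_H[of "\<phi> x"] inv(1,3) \<open>s \<noteq> 0\<close> by (auto simp: W_def h_def)
  \<comment> \<open>The factor \<open>c\<close> is \<open>1\<close> for the positive and \<open>-1\<close> for the negative side.\<close>
  have side: "W \<inter> {x. 0 < c * h x} \<subseteq> interior K \<or> W \<inter> {x. 0 < c * h x} \<inter> K = {}" for c
  proof (rule subset_interior_or_disjoint_if_connected[OF _ _ K(1)])
    have "W \<inter> {x. 0 < c * h x} = \<psi> ` (ball (\<phi> p) r \<inter> {y. (c * s) *\<^sub>R a \<bullet> y > 0})" (is "?A = \<psi> ` ?B")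
    proof
      show "?A \<subseteq> \<psi> ` ?B"
      proof
        fix x assume "x \<in> ?A"
        then show "x \<in> \<psi> ` ?B"
          using inv(1) by (intro image_eqI[of _ _ "\<phi> x"]) (auto simp: W_def h_def mult.assoc)
      qed
      show "\<psi> ` ?B \<subseteq> ?A"
      proof
        fix x assume "x \<in> \<psi> ` ?B"
        then obtain y where "x = \<psi> y" "y \<in> ?B" by blast
        moreover from this have "y \<in> V" using r by blast
        ultimately show "x \<in> ?A"
          using inv(2,4) by (auto simp: W_def h_def mult.assoc)
      qed
    qed
    moreover have "connected ?B"
      by (intro convex_connected convex_Int convex_ball convex_halfspace_gt)
    moreover have "continuous_on ?B \<psi>"
      using r by (intro continuous_on_subset[OF cont(2)]) auto
    ultimately show "connected ?A"
      by (simp only: connected_continuous_image)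
    show "?A \<inter> frontier K = {}"
      using W_H K(2) by auto
  qed
  have nu_dir: "\<forall>\<^sub>F t in at_right 0. p + t *\<^sub>R \<nu> \<in> W \<and> 0 < h (p + t *\<^sub>R \<nu>) \<and> p + t *\<^sub>R \<nu> \<in> interior K"
  proof -
    have "((\<lambda>t. h (p + t *\<^sub>R \<nu>)) has_derivative (\<lambda>t. \<nu> \<bullet> (t *\<^sub>R \<nu>))) (at 0)"
      by (rule has_derivative_compose[where g = h and s = UNIV, simplified])
         (use h_deriv in \<open>auto intro!: derivative_eq_intros\<close>)
    then have "DERIV (\<lambda>t. h (p + t *\<^sub>R \<nu>)) 0 :> 1"
      unfolding has_field_derivative_def
      by (rule has_derivative_eq_rhs) (simp add: fun_eq_iff dot_square_norm nu1)
    from DERIV_pos_inc_right[OF this] obtain d where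
      d: "d > 0" "\<And>t. 0 < t \<Longrightarrow> t < d \<Longrightarrow> 0 < h (p + t *\<^sub>R \<nu>)"
      using h_p by auto
    have "\<forall>\<^sub>F t in at_right 0. 0 < h (p + t *\<^sub>R \<nu>)"
      using d by (auto simp: eventually_at_right_field)
    moreover have "\<forall>\<^sub>F t in at_right 0. p + t *\<^sub>R \<nu> \<in> interior K"
      using nu unfolding inward_unit_normal_def by (auto simp: eventually_at_right_field)
    moreover have "((\<lambda>t. p + t *\<^sub>R \<nu>) \<longlongrightarrow> p + 0 *\<^sub>R \<nu>) (at_right 0)"
      by (intro tendsto_intros)
    then have "\<forall>\<^sub>F t in at_right 0. p + t *\<^sub>R \<nu> \<in> W"
      using W by (intro topological_tendstoD[of _ p]) auto
    ultimately show ?thesis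
      by eventually_elim simp
  qed
  then obtain t where "p + t *\<^sub>R \<nu> \<in> W \<inter> {x. 0 < 1 * h x}" "p + t *\<^sub>R \<nu> \<in> interior K"
    using eventually_happens[OF nu_dir] by auto
  with side[of 1] have pos: "W \<inter> {x. 0 < 1 * h x} \<subseteq> interior K"
    using interior_subset by blast
  \<comment> \<open>If the other side of \<open>H\<close> also met \<open>K\<close>, then \<open>p\<close> would be an interior point of \<open>K\<close>.\<close>
  have neg: "W \<inter> {x. 0 < (-1) * h x} \<inter> K = {}"
  proof (rule ccontr)
    assume "W \<inter> {x. 0 < (-1) * h x} \<inter> K \<noteq> {}"
    with side[of "-1"] have "W \<inter> {x. 0 < (-1) * h x} \<subseteq> K"
      using interior_subset by blast
    moreover have "H \<subseteq> K"
      using K by (auto simp: frontier_def)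
    moreover have "x \<in> H \<or> 0 < 1 * h x \<or> 0 < (-1) * h x" if "x \<in> W" for x
      using W_H[OF that] by auto
    ultimately have "W \<subseteq> K"
      using pos interior_subset by blast
    then have "p \<in> interior K"
      using W interiorI by blast
    then show False
      using p K(2) by (auto simp: frontier_def)
  qed
  show thesis
    using W h_p h_deriv pos neg by (intro that[of W h]) auto
qed

text \<open>Along the curve, the defining function vanishes at \<open>t0\<close> and has the positive derivative
  \<open>\<nu> \<bullet> v\<close> there, so it changes sign from negative to positive.\<close>

lemma crosses_inward:
  fixes H K :: "'a::euclidean_space set"
  assumes sub: "smooth_submanifold (DIM('a) - 1) H"
    and K: "closed K" "frontier K = H"
    and p: "x t0 \<in> H"
    and nu: "inward_unit_normal H K (x t0) \<nu>"
    and x: "(x has_vector_derivative v) (at t0)"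
    and pos: "\<nu> \<bullet> v > 0"
  shows "\<forall>\<^sub>F t in at_right t0. x t \<in> interior K" "\<forall>\<^sub>F t in at_left t0. x t \<notin> K"
proof -
  obtain W h where W: "open W" "x t0 \<in> W" and h: "h (x t0) = 0" "(h has_derivative (\<lambda>v. \<nu> \<bullet> v)) (at (x t0))"
    and side: "\<And>x. x \<in> W \<Longrightarrow> 0 < h x \<Longrightarrow> x \<in> interior K"
    "\<And>x. x \<in> W \<Longrightarrow> h x < 0 \<Longrightarrow> x \<notin> K"
    using inward_defining_function[OF sub K p nu] by metis
  have "((\<lambda>t. h (x t)) has_derivative (\<lambda>t. \<nu> \<bullet> (t *\<^sub>R v))) (at t0)"
    by (rule has_derivative_compose[OF x[unfolded has_vector_derivative_def] h(2)])
  then have D: "DERIV (\<lambda>t. h (x t)) t0 :> \<nu> \<bullet> v"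
    unfolding has_field_derivative_def
    by (rule has_derivative_eq_rhs) (simp add: fun_eq_iff)
  have "isCont x t0"
    using has_vector_derivative_continuous[OF x] .
  then have "\<forall>\<^sub>F t in at t0. x t \<in> W"
    using W by (auto simp: isCont_def intro: topological_tendstoD)
  then have W': "\<forall>\<^sub>F t in at_left t0. x t \<in> W" "\<forall>\<^sub>F t in at_right t0. x t \<in> W"
    by (auto simp: eventually_at_split)
  have "\<forall>\<^sub>F t in at_right t0. 0 < h (x t)"
  proof -
    obtain d where d: "d > 0" "\<And>s. 0 < s \<Longrightarrow> s < d \<Longrightarrow> 0 < h (x (t0 + s))"
      using DERIV_pos_inc_right[OF D pos] h(1) by auto
    show ?thesis
      using d(1) d(2)[of "t - t0" for t] by (auto simp: eventually_at_right_field intro!: exI[of _ "t0 + d"])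
  qed
  with W'(2) show "\<forall>\<^sub>F t in at_right t0. x t \<in> interior K"
    by eventually_elim (rule side(1))
  have "\<forall>\<^sub>F t in at_left t0. h (x t) < 0"
  proof -
    obtain d where d: "d > 0" "\<And>s. 0 < s \<Longrightarrow> s < d \<Longrightarrow> h (x (t0 - s)) < 0"
      using DERIV_pos_inc_left[OF D pos] h(1) by auto
    show ?thesis
      using d(1) d(2)[of "t0 - t" for t] by (auto simp: eventually_at_left_field intro!: exI[of _ "t0 - d"])
  qed
  with W'(1) show "\<forall>\<^sub>F t in at_left t0. x t \<notin> K"
    by eventually_elim (rule side(2))
qed

section \<open>Solutions of a continuous system with unique solutions\<close>

locale autonomous_ode =
  fixes G :: "'a::euclidean_space set" and f :: "'a \<Rightarrow> 'a"
  assumes continuous_field: "continuous_on G f"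
    and unique: "unique_solutions G f"
begin

text \<open>In contrast to \<open>solution_through\<close>, the time domain may contain endpoints, at which the derivative
  is one-sided. Pieces of solutions can then be joined and continued at endpoints.\<close>

definition solves_on :: "(real \<Rightarrow> 'a) \<Rightarrow> real set \<Rightarrow> bool" where
  "solves_on x S \<longleftrightarrow> (\<forall>t\<in>S. x t \<in> G \<and> (x has_vector_derivative f (x t)) (at t within S))"

lemma solves_on_subset: "solves_on x S \<Longrightarrow> T \<subseteq> S \<Longrightarrow> solves_on x T"
  unfolding solves_on_def using has_vector_derivative_within_subset by blast

lemma solution_through_iff:
  "solution_through G f p J x \<longleftrightarrow> open J \<and> is_interval J \<and> 0 \<in> J \<and> x 0 = p \<and> solves_on x J"
  unfolding solution_through_def solves_on_def
  using has_vector_derivative_within_open[of _ J x] by blast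

lemma through_unique:
  assumes "p \<in> G" "solution_through G f p J x" "solution_through G f p J' x'" "t \<in> J" "t \<in> J'"
  shows "x t = x' t"
  using assms unique unfolding unique_solutions_def by blast

lemma solves_on_continuous: "solves_on x S \<Longrightarrow> continuous_on S x"
  unfolding solves_on_def continuous_on_eq_continuous_within
  using has_vector_derivative_continuous by blast

lemma solves_on_cong:
  assumes "solves_on x S" "\<And>t. t \<in> S \<Longrightarrow> y t = x t"
  shows "solves_on y S"
  using assms has_vector_derivative_transform[of _ S y x]
  unfolding solves_on_def by (metis (full_types))

lemma solves_on_shift:
  assumes "solves_on x S" "\<And>t. t \<in> T \<Longrightarrow> t + s \<in> S"
  shows "solves_on (\<lambda>t. x (t + s)) T"
  unfolding solves_on_def
proof (intro ballI conjI)
  fix t assume t: "t \<in> T"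
  show "x (t + s) \<in> G"
    using assms t unfolding solves_on_def by blast
  have "(x has_vector_derivative f (x (t + s))) (at (t + s) within (\<lambda>t. t + s) ` T)"
    using assms t unfolding solves_on_def
    by (meson has_vector_derivative_within_subset image_subsetI)
  moreover have "((\<lambda>t. t + s) has_vector_derivative 1) (at t within T)"
    by (auto intro!: derivative_eq_intros)
  ultimately show "((\<lambda>t. x (t + s)) has_vector_derivative f (x (t + s))) (at t within T)"
    using vector_diff_chain_within[of "\<lambda>t. t + s" 1 t T x "f (x (t + s))"] by (simp add: o_def)
qed

lemma solves_on_concat:
  assumes x: "solves_on x A" and y: "solves_on y B"
    and AB: "A \<subseteq> {..c}" "B \<subseteq> {c..}" "c \<in> A" "c \<in> B" "x c = y c"
  shows "solves_on (\<lambda>t. if t \<in> A then x t else y t) (A \<union> B)"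
  unfolding solves_on_def
proof (intro ballI conjI)
  fix t assume t: "t \<in> A \<union> B"
  show "(if t \<in> A then x t else y t) \<in> G"
    using t x y unfolding solves_on_def by auto
  have "closure A \<subseteq> {..c}" "closure B \<subseteq> {c..}"
    using AB by (simp_all add: closure_minimal)
  then have cl: "u = c" if "u \<in> closure A" "u \<in> closure B" for u
    using that by force
  have A: "A \<union> closure A \<inter> closure B = A" "B \<union> closure A \<inter> closure B = B"
    using cl AB by blast+
  have in_both: "t \<in> A \<and> t \<in> B \<and> x t = y t" if "t \<in> closure A" "t \<in> closure B"
    using cl[OF that] AB by simp
  have deriv: "t \<in> A \<Longrightarrow> (x has_vector_derivative f (x t)) (at t within A)"
      "t \<in> B \<Longrightarrow> (y has_vector_derivative f (y t)) (at t within B)"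
    using x y unfolding solves_on_def by blast+
  have "((\<lambda>t. if t \<in> A then x t else y t) has_vector_derivative
      (if t \<in> A then f (x t) else f (y t))) (at t within A \<union> B)"
  proof (rule has_vector_derivative_If_within_closures[OF t refl], unfold A)
    show "t \<in> A \<Longrightarrow> (x has_vector_derivative f (x t)) (at t within A)"
      by (rule deriv)
    show "t \<in> B \<Longrightarrow> (y has_vector_derivative f (y t)) (at t within B)"
      by (rule deriv)
  qed (use in_both in auto)
  then show "((\<lambda>t. if t \<in> A then x t else y t) has_vector_derivative
      f (if t \<in> A then x t else y t)) (at t within A \<union> B)"
    by (simp add: if_distrib)
qed

text \<open>Uniqueness is given for solutions on open intervals around the initial time. This extension
  makes it available for solutions that start at time \<open>0\<close>; \<open>S\<close> stands for \<open>{0..<b}\<close> or \<open>{0..}\<close>.\<close>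

lemma solves_on_extend_backward:
  assumes x: "solves_on x S" and S: "is_interval S" "0 \<in> S" "S \<subseteq> {0..}"
    and op: "\<And>e. e > 0 \<Longrightarrow> open ({-e<..0} \<union> S)"
  obtains e y where "e > 0" "solution_through G f (x 0) ({-e<..0} \<union> S) y"
    "\<And>t. t \<in> S \<Longrightarrow> y t = x t"
proof -
  have "x 0 \<in> G"
    using x S unfolding solves_on_def by blast
  then obtain J z where z: "solution_through G f (x 0) J z"
    using unique unfolding unique_solutions_def by blast
  then have J: "open J" "0 \<in> J" "z 0 = x 0" "solves_on z J"
    unfolding solution_through_iff by auto
  then obtain e where e: "e > 0" "ball 0 e \<subseteq> J"
    using open_contains_ball by blast
  then have "{-e<..0} \<subseteq> J"
    by (force simp: dist_norm)
  then have z': "solves_on z {-e<..0}"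
    using J solves_on_subset by blast
  define y where "y t = (if t \<in> {-e<..0} then z t else x t)" for t
  have y: "solves_on y ({-e<..0} \<union> S)"
    unfolding y_def using e S J by (intro solves_on_concat[OF z' x, of 0]) auto
  moreover have "is_interval ({-e<..0} \<union> S)"
  proof -
    have "0 \<in> {-e<..0} \<inter> S"
      using e S by simp
    then show ?thesis
      using S(1) connected_Ioc[of "-e" 0] unfolding is_interval_connected_1
      by (intro connected_Un) blast+
  qed
  moreover have "y t = x t" if "t \<in> S" for t
    using that J S by (force simp: y_def)
  ultimately show thesis
    using e op S J by (intro that[of e y]) (auto simp: solution_through_iff y_def)
qed

lemma solves_on_unique:
  assumes x: "solves_on x {0..b}" and y: "solves_on y {0..b}" and 0: "x 0 = y 0"
    and t: "t \<in> {0..b}"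
  shows "x t = y t"
proof (cases "b = 0")
  case False
  then have b: "b > 0"
    using t by auto
  have op: "open ({-e<..0} \<union> {0..<b})" if "e > 0" for e
  proof -
    have "{-e<..0} \<union> {0..<b} = {-e<..<b}"
      using that b by auto
    then show ?thesis by simp
  qed
  have half: "solves_on x {0..<b}" "solves_on y {0..<b}"
    using x y by (auto elim: solves_on_subset)
  obtain e1 X where X: "solution_through G f (x 0) ({-e1<..0} \<union> {0..<b}) X"
      "\<And>t. t \<in> {0..<b} \<Longrightarrow> X t = x t"
    by (rule solves_on_extend_backward[OF half(1) _ _ _ op]) (use b in auto)
  obtain e2 Y where Y: "solution_through G f (y 0) ({-e2<..0} \<union> {0..<b}) Y"
      "\<And>t. t \<in> {0..<b} \<Longrightarrow> Y t = y t"
    by (rule solves_on_extend_backward[OF half(2) _ _ _ op]) (use b in auto)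
  have "x 0 \<in> G"
    using half(1) b unfolding solves_on_def by auto
  then have "X t = Y t" if "t \<in> {0..<b}" for t
    using that through_unique[OF _ X(1) Y(1)[folded 0]] by blast
  then have eq: "x t - y t = 0" if "t \<in> {0..<b}" for t
    using that X(2) Y(2) by simp
  have "x t - y t = 0"
  proof (rule continuous_constant_on_closure[of "{0..<b}" "\<lambda>t. x t - y t"])
    show "continuous_on (closure {0..<b}) (\<lambda>t. x t - y t)"
      using b solves_on_continuous[OF x] solves_on_continuous[OF y]
      by (auto intro: continuous_on_diff)
  qed (use eq b t in auto)
  then show ?thesis by simp
qed (use 0 t in auto)

lemma solution_through_forward:
  assumes "solution_through G f p J x" "t \<in> J"
  shows "solves_on x {0..t}"
proof -
  have "{0..t} \<subseteq> J"
    using assms unfolding solution_through_iff is_interval_1 by (meson atLeastAtMost_iff subsetI)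
  then show ?thesis
    using assms solves_on_subset unfolding solution_through_iff by blast
qed

section \<open>Solutions in a compact set\<close>

lemma field_bound:
  assumes "compact C" "C \<subseteq> G"
  obtains M where "M > 0" "\<And>c. c \<in> C \<Longrightarrow> norm (f c) \<le> M"
proof -
  have "bounded (f ` C)"
    using assms continuous_field compact_continuous_image compact_imp_bounded continuous_on_subset
    by metis
  then obtain M where "M > 0" "\<forall>y\<in>f ` C. norm y \<le> M"
    unfolding bounded_pos by blast
  then show thesis
    using that by blast
qed

lemma solves_on_lipschitz:
  assumes x: "solves_on x S" and S: "convex S" and M: "\<And>t. t \<in> S \<Longrightarrow> norm (f (x t)) \<le> M"
    and t: "t \<in> S" "u \<in> S"
  shows "norm (x t - x u) \<le> M * \<bar>t - u\<bar>"
proof -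
  have "norm (x t - x u) \<le> M * norm (t - u)"
  proof (rule differentiable_bound[OF S])
    show "(x has_derivative (\<lambda>h. h *\<^sub>R f (x s))) (at s within S)" if "s \<in> S" for s
      using x that unfolding solves_on_def has_vector_derivative_def by blast
    show "onorm (\<lambda>h::real. h *\<^sub>R f (x s)) \<le> M" if "s \<in> S" for s
    proof (rule onorm_le)
      show "norm (h *\<^sub>R f (x s)) \<le> M * norm h" for h :: real
        using mult_right_mono[OF M[OF that], of "norm h"] by (simp add: mult.commute)
    qed
  qed (use t in auto)
  then show ?thesis by simp
qed

text \<open>The field is bounded on \<open>C\<close>, so the solution is Lipschitz and has a limit at \<open>b\<close>. The extended
  curve still solves the equation at \<open>b\<close>, because it differs by a constant from the integral of the
  continuous function \<open>f (y s)\<close>.\<close>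

lemma solves_on_extend_to_endpoint:
  assumes C: "compact C" "C \<subseteq> G" and x: "solves_on x {0..<b}" and b: "b > 0"
    and xC: "x ` {0..<b} \<subseteq> C"
  obtains y where "solves_on y {0..b}" "y ` {0..b} \<subseteq> C" "\<And>t. t \<in> {0..<b} \<Longrightarrow> y t = x t"
proof -
  obtain M where M: "M > 0" "\<And>c. c \<in> C \<Longrightarrow> norm (f c) \<le> M"
    using field_bound[OF C] by blast
  have cl: "closure {0..<b} = {0..b}"
    using b by simp
  have "norm (x t - x u) \<le> M * \<bar>t - u\<bar>" if "t \<in> {0..<b}" "u \<in> {0..<b}" for t u
    by (rule solves_on_lipschitz[OF x _ M(2)[OF subsetD[OF xC imageI]] that]) auto
  then have "M-lipschitz_on {0..<b} x"
    using M by (intro lipschitz_onI) (auto simp: dist_norm)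
  then have "uniformly_continuous_on {0..<b} x"
    by (rule lipschitz_on_uniformly_continuous)
  then obtain y where y: "uniformly_continuous_on {0..b} y" "\<And>t. t \<in> {0..<b} \<Longrightarrow> x t = y t"
    using uniformly_continuous_on_extension_on_closure cl by metis
  have cont_y: "continuous_on {0..b} y"
    using y(1) by (rule uniformly_continuous_imp_continuous)
  have "y ` closure {0..<b} \<subseteq> C"
    using image_closure_subset[of "{0..<b}" y C] cont_y cl C(1) compact_imp_closed xC y(2)
    by (metis (no_types, lifting) image_cong)
  then have yC: "y ` {0..b} \<subseteq> C"
    by (simp only: cl)
  define z where "z t = integral {0..t} (\<lambda>s. f (y s))" for t
  have z: "(z has_vector_derivative f (y t)) (at t within {0..b})" if "t \<in> {0..b}" for t
    unfolding z_def
    using continuous_on_compose2[OF continuous_field cont_y] yC C(2)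
    by (intro integral_has_vector_derivative[OF _ that]) blast
  have "\<exists>c. \<forall>t\<in>{0..<b}. y t - z t = c"
  proof (rule has_derivative_zero_constant)
    fix t assume t: "t \<in> {0..<b}"
    have "(z has_vector_derivative f (y t)) (at t within {0..<b})"
      using z[of t] t by (auto elim: has_vector_derivative_within_subset)
    moreover have "(y has_vector_derivative f (y t)) (at t within {0..<b})"
      using x solves_on_cong[OF x, of y] y(2) t unfolding solves_on_def by simp
    ultimately have "((\<lambda>t. y t - z t) has_vector_derivative f (y t) - f (y t)) (at t within {0..<b})"
      by (intro has_vector_derivative_diff)
    then show "((\<lambda>t. y t - z t) has_derivative (\<lambda>h. 0)) (at t within {0..<b})"
      by (simp add: has_vector_derivative_def)
  qed simp
  then obtain c where c: "\<And>t. t \<in> {0..<b} \<Longrightarrow> y t - z t = c"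
    by blast
  have "continuous_on {0..b} z"
    unfolding continuous_on_eq_continuous_within using z has_vector_derivative_continuous by blast
  then have c': "y t - z t = c" if "t \<in> {0..b}" for t
    using continuous_constant_on_closure[of "{0..<b}" "\<lambda>t. y t - z t" c t] c that cont_y
    by (simp only: cl) (auto intro: continuous_on_diff)
  have "(y has_vector_derivative f (y t)) (at t within {0..b})" if "t \<in> {0..b}" for t
  proof (rule has_vector_derivative_transform[OF that])
    show "((\<lambda>t. z t + c) has_vector_derivative f (y t)) (at t within {0..b})"
      using z[OF that] by (auto intro!: derivative_eq_intros)
  qed (use c' in \<open>auto simp: algebra_simps\<close>)
  then have "solves_on y {0..b}"
    unfolding solves_on_def using yC C(2) by auto
  then show thesis
    using that yC y(2) by metis
qed

text \<open>The solutions are equicontinuous because the field is bounded on \<open>C\<close>, so the Arzela-Ascoli theorem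
  gives a uniformly convergent subsequence. As the field is uniformly continuous on \<open>C\<close>, the derivatives
  converge uniformly too, and the limit is a solution.\<close>

lemma solutions_compact:
  assumes C: "compact C" "C \<subseteq> G" and b: "b \<ge> 0"
    and X: "\<And>n. solves_on (X n) {0..b}" "\<And>n t. t \<in> {0..b} \<Longrightarrow> X n t \<in> C"
  obtains r g where "strict_mono (r :: nat \<Rightarrow> nat)" "solves_on g {0..b}"
    "uniform_limit {0..b} (\<lambda>n. X (r n)) g sequentially"
proof -
  obtain M where M: "M > 0" "\<And>c. c \<in> C \<Longrightarrow> norm (f c) \<le> M"
    using field_bound[OF C] by blast
  obtain B where B: "\<And>c. c \<in> C \<Longrightarrow> norm c \<le> B"
    using compact_imp_bounded[OF C(1)] unfolding bounded_iff by blast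
  have lip: "norm (X n t - X n u) \<le> M * \<bar>t - u\<bar>" if "t \<in> {0..b}" "u \<in> {0..b}" for n t u
    by (rule solves_on_lipschitz[OF X(1) _ M(2)[OF X(2)] that]) auto
  obtain g r where r: "strict_mono (r :: nat \<Rightarrow> nat)"
    and lim: "\<And>e. 0 < e \<Longrightarrow> \<exists>N. \<forall>n x. n \<ge> N \<and> x \<in> {0..b} \<longrightarrow> norm (X (r n) x - g x) < e"
  proof (rule Arzela_Ascoli[of "{0..b}" X B])
    show "norm (X n t) \<le> B" if "t \<in> {0..b}" for n t
      using B X(2)[OF that] by blast
    show "\<exists>d>0. \<forall>n u. u \<in> {0..b} \<and> norm (t - u) < d \<longrightarrow> norm (X n t - X n u) < e"
      if "t \<in> {0..b}" "0 < e" for t e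
    proof (intro exI[of _ "e / M"] conjI allI impI)
      fix n u assume u: "u \<in> {0..b} \<and> norm (t - u) < e / M"
      then have "M * \<bar>t - u\<bar> < e"
        using M(1) by (simp add: field_simps)
      then show "norm (X n t - X n u) < e"
        using lip[OF that(1), of u n] u by linarith
    qed (use that M in auto)
  qed (auto intro: that)
  have ul: "uniform_limit {0..b} (\<lambda>n. X (r n)) g sequentially"
    unfolding uniform_limit_sequentially_iff dist_norm using lim by meson
  have pw: "(\<lambda>n. X (r n) t) \<longlonglongrightarrow> g t" if "t \<in> {0..b}" for t
    using tendsto_uniform_limitI[OF ul that] .
  have gC: "g t \<in> C" if "t \<in> {0..b}" for t
    using closed_sequentially[OF compact_imp_closed[OF C(1)] _ pw[OF that]] X(2)[OF that] by blast
  have uc: "uniformly_continuous_on C f"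
    using C continuous_field compact_uniformly_continuous continuous_on_subset by metis
  have "\<exists>g2. \<forall>t\<in>{0..b}. (\<lambda>n. X (r n) t) \<longlonglongrightarrow> g2 t \<and>
      (g2 has_derivative (\<lambda>h. h *\<^sub>R f (g t))) (at t within {0..b})"
  proof (rule has_derivative_sequence[where f' = "\<lambda>n t h. h *\<^sub>R f (X (r n) t)"])
    show "(X (r n) has_derivative (\<lambda>h. h *\<^sub>R f (X (r n) t))) (at t within {0..b})"
      if "t \<in> {0..b}" for n t
      using X(1)[of "r n"] that unfolding solves_on_def has_vector_derivative_def by blast
    show "\<forall>\<^sub>F n in sequentially. \<forall>t\<in>{0..b}. \<forall>h.
        norm (h *\<^sub>R f (X (r n) t) - h *\<^sub>R f (g t)) \<le> e * norm h" if e: "e > 0" for e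
    proof -
      obtain d where d: "d > 0"
          "\<And>c c'. c \<in> C \<Longrightarrow> c' \<in> C \<Longrightarrow> dist c' c < d \<Longrightarrow> dist (f c') (f c) < e"
        using uc e unfolding uniformly_continuous_on_def by blast
      from uniform_limitD[OF ul d(1)] show ?thesis
      proof eventually_elim
        case (elim n)
        show ?case
        proof (intro ballI allI)
          fix t h :: real assume t: "t \<in> {0..b}"
          have "norm (f (X (r n) t) - f (g t)) \<le> e"
            using d(2)[OF gC[OF t] X(2)[OF t], of "r n"] elim t by (auto simp: dist_norm)
          from mult_left_mono[OF this, of "\<bar>h\<bar>"]
          show "norm (h *\<^sub>R f (X (r n) t) - h *\<^sub>R f (g t)) \<le> e * norm h"
            by (simp add: scaleR_diff_right[symmetric] mult.commute[of e])
        qed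
      qed
    qed
    show "(\<lambda>n. X (r n) 0) \<longlonglongrightarrow> g 0"
      using pw b by simp
  qed (use b in auto)
  then obtain g2 where g2: "\<And>t. t \<in> {0..b} \<Longrightarrow> (\<lambda>n. X (r n) t) \<longlonglongrightarrow> g2 t"
      "\<And>t. t \<in> {0..b} \<Longrightarrow> (g2 has_vector_derivative f (g t)) (at t within {0..b})"
    unfolding has_vector_derivative_def by blast
  have eq: "g t = g2 t" if "t \<in> {0..b}" for t
    using LIMSEQ_unique pw g2(1) that by blast
  then have "solves_on g {0..b}"
    unfolding solves_on_def
    using has_vector_derivative_transform[OF _ eq g2(2)] gC C(2) by blast
  then show thesis
    using that r ul by blast
qed

section \<open>The forward flow on a trapping set\<close>

text \<open>The condition is local: solutions starting in \<open>C\<close> remain there for a short time. That they remain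
  there forever, and exist forever, is shown in \<open>global_solution\<close>.\<close>

definition forward_invariant :: "'a set \<Rightarrow> bool" where
  "forward_invariant C \<longleftrightarrow> compact C \<and> C \<subseteq> G \<and>
     (\<forall>q\<in>C. \<forall>J x. solution_through G f q J x \<longrightarrow> (\<forall>\<^sub>F t in at_right 0. x t \<in> C))"

text \<open>The choice is meaningful only at points from which a solution exists for all positive times,
  such as those of a forward invariant set.\<close>

definition flow :: "'a \<Rightarrow> real \<Rightarrow> 'a" where
  "flow q = (SOME x. x 0 = q \<and> solves_on x {0..})"

lemma local_solution_in:
  assumes C: "forward_invariant C" and q: "q \<in> C"
  obtains e x where "e > 0" "x 0 = q" "solves_on x {0..e}" "x ` {0..e} \<subseteq> C"
proof -
  have "q \<in> G"
    using C q unfolding forward_invariant_def by blast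
  then obtain J x where x: "solution_through G f q J x"
    using unique unfolding unique_solutions_def by blast
  then have J: "open J" "0 \<in> J" "x 0 = q"
    unfolding solution_through_iff by auto
  have "\<forall>\<^sub>F t in at_right 0. x t \<in> C"
    using C q x unfolding forward_invariant_def by blast
  then obtain d where d: "d > 0" "\<And>t. 0 < t \<Longrightarrow> t < d \<Longrightarrow> x t \<in> C"
    unfolding eventually_at_right_field by auto
  obtain e where e: "e > 0" "ball 0 e \<subseteq> J"
    using J open_contains_ball by blast
  define b where "b = min d e / 2"
  have b: "b > 0" "b < d" "b < e"
    using d e unfolding b_def by (auto simp: min_def)
  then have "b \<in> J"
    using e by (auto simp: dist_norm)
  then have "solves_on x {0..b}"
    using solution_through_forward[OF x] by blast
  moreover have "x t \<in> C" if "t \<in> {0..b}" for t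
    using d(2)[of t] that b J(3) q by (cases "t = 0") auto
  ultimately show thesis
    using that[of b x] b J(3) by blast
qed

text \<open>Solutions on the intervals \<open>{0..T}\<close> agree where both are defined, so they combine to the diagonal
  \<open>x t = X t t\<close>. As \<open>I\<close> has no greatest element, each of its points has a later one, so that the
  combined function coincides with one of the given solutions on both sides of the point.\<close>

lemma solution_from_initial_segments:
  assumes seg: "\<And>T. T \<in> I \<Longrightarrow> \<exists>x. x 0 = q \<and> solves_on x {0..T} \<and> x ` {0..T} \<subseteq> C"
    and I: "I \<subseteq> {0..}" "\<And>T. T \<in> I \<Longrightarrow> {0..T} \<subseteq> I" "\<And>T. T \<in> I \<Longrightarrow> \<exists>T'\<in>I. T < T'" "0 \<in> I"
  obtains x where "x 0 = q" "solves_on x I" "x ` I \<subseteq> C"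
proof -
  obtain X where X: "\<And>T. T \<in> I \<Longrightarrow> X T 0 = q \<and> solves_on (X T) {0..T} \<and> X T ` {0..T} \<subseteq> C"
    using seg by metis
  define x where "x t = X t t" for t
  have eq: "x t = X T t" if "T \<in> I" "t \<in> {0..T}" for t T
    unfolding x_def
  proof (rule solves_on_unique[of "X t" t "X T"])
    have "t \<in> I"
      using I(2) that by blast
    then show "solves_on (X t) {0..t}" "X t 0 = X T 0"
      using X that by auto
    show "solves_on (X T) {0..t}"
      using X[OF that(1)] that(2) by (auto elim: solves_on_subset)
    show "t \<in> {0..t}"
      using that by simp
  qed
  have "solves_on x I"
    unfolding solves_on_def
  proof
    fix t assume t: "t \<in> I"
    then obtain T where T: "T \<in> I" "t < T"
      using I(3) by blast
    then have "solves_on x {0..T}"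
      using X[OF T(1)] eq[OF T(1)] solves_on_cong by blast
    moreover have "at t within {0..T} = at t within I"
    proof (rule at_within_nhd[of t "{..<T}"])
      have "{0..T} \<inter> {..<T} = I \<inter> {..<T}"
        using I(1) I(2)[OF T(1)] by force
      then show "{0..T} \<inter> {..<T} - {t} = I \<inter> {..<T} - {t}"
        by simp
    qed (use T in auto)
    moreover have "t \<in> {0..T}"
      using t T I(1) by auto
    ultimately show "x t \<in> G \<and> (x has_vector_derivative f (x t)) (at t within I)"
      unfolding solves_on_def by fastforce
  qed
  moreover have "x t \<in> C" if "t \<in> I" for t
  proof -
    have "t \<in> {0..t}"
      using I(1) that by auto
    then show ?thesis
      using X[OF that] unfolding x_def by blast
  qed
  ultimately show thesis
    using X[OF I(4)] by (intro that[of x]) (auto simp: x_def)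
qed

text \<open>Let \<open>s\<close> be the supremum of the times up to which a solution in \<open>C\<close> exists. If \<open>s\<close> were finite, the
  solution could be extended to \<open>s\<close> by compactness, and past \<open>s\<close> by a local solution.\<close>

lemma global_solution:
  assumes C: "forward_invariant C" and q: "q \<in> C"
  obtains x where "x 0 = q" "solves_on x {0..}" "x ` {0..} \<subseteq> C"
proof -
  define P where "P T \<longleftrightarrow> (\<exists>x. x 0 = q \<and> solves_on x {0..T} \<and> x ` {0..T} \<subseteq> C)" for T
  have CG: "compact C" "C \<subseteq> G"
    using C unfolding forward_invariant_def by auto
  have down: "P t" if "P T" "t \<le> T" for t T
  proof -
    have "{0..t} \<subseteq> {0..T}"
      using that by auto
    then show ?thesis
      using that(1) solves_on_subset unfolding P_def by blast
  qed
  have "P T" if "T \<ge> 0" for T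
  proof (rule ccontr)
    assume nP: "\<not> P T"
    define S where "S = {t. 0 \<le> t \<and> P t}"
    define s where "s = Sup S"
    obtain e0 where e0: "e0 > 0" "P e0"
      using local_solution_in[OF C q] unfolding P_def by metis
    have "t \<le> T" if "t \<in> S" for t
      using that nP down[of t T] unfolding S_def by force
    then have bdd: "bdd_above S"
      unfolding bdd_above_def by blast
    have "e0 \<in> S"
      using e0 by (simp add: S_def)
    then have "s \<ge> e0"
      unfolding s_def using bdd by (rule cSup_upper)
    then have s: "s > 0"
      using e0 by simp
    have Ps: "P t" if "t < s" for t
    proof -
      have "S \<noteq> {}"
        using \<open>e0 \<in> S\<close> by blast
      from less_cSupD[OF this that[unfolded s_def]] obtain u where "u \<in> S" "t < u"
        by blast
      then show ?thesis
        using down[of u t] unfolding S_def by simp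
    qed
    obtain x where x: "x 0 = q" "solves_on x {0..<s}" "x ` {0..<s} \<subseteq> C"
    proof (rule solution_from_initial_segments[of "{0..<s}" q C])
      show "\<exists>x. x 0 = q \<and> solves_on x {0..T} \<and> x ` {0..T} \<subseteq> C" if "T \<in> {0..<s}" for T
        using Ps[of T] that unfolding P_def by simp
      show "\<exists>T'\<in>{0..<s}. T < T'" if "T \<in> {0..<s}" for T
        using that dense[of T s] by auto
    qed (use s in auto)
    obtain y where y: "solves_on y {0..s}" "y ` {0..s} \<subseteq> C" "\<And>t. t \<in> {0..<s} \<Longrightarrow> y t = x t"
      using solves_on_extend_to_endpoint[OF CG x(2) s x(3)] by blast
    have "y s \<in> C"
      using y(2) s by auto
    then obtain e z where z: "e > 0" "z 0 = y s" "solves_on z {0..e}" "z ` {0..e} \<subseteq> C"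
      using local_solution_in[OF C] by blast
    have "solves_on (\<lambda>t. z (t + - s)) {s..s + e}"
      by (rule solves_on_shift[OF z(3)]) auto
    then have "solves_on (\<lambda>t. if t \<in> {0..s} then y t else z (t + - s)) ({0..s} \<union> {s..s + e})"
      using s z(1,2) by (intro solves_on_concat[OF y(1), where c = s]) auto
    moreover have "{0..s} \<union> {s..s + e} = {0..s + e}"
      using s z(1) by auto
    ultimately have "P (s + e)"
      unfolding P_def using y(2) y(3)[of 0] s x(1) z(4)
      by (intro exI[of _ "\<lambda>t. if t \<in> {0..s} then y t else z (t + - s)"]) (auto simp: image_subset_iff)
    then have "s + e \<in> S"
      using s z(1) by (simp add: S_def)
    then have "s + e \<le> s"
      unfolding s_def using bdd by (rule cSup_upper)
    then show False
      using z(1) by simp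
  qed
  then obtain x where "x 0 = q" "solves_on x {0..}" "x ` {0..} \<subseteq> C"
  proof (rule_tac solution_from_initial_segments[of "{0..}" q C])
    show "\<exists>T'\<in>{0..}. T < T'" if "T \<in> {0..}" for T :: real
      using that by (intro bexI[of _ "T + 1"]) auto
  qed (auto simp: P_def)
  then show thesis by (rule that)
qed

context
  fixes C
  assumes C: "forward_invariant C"
begin

lemma flow:
  assumes "q \<in> C"
  shows "flow q 0 = q" "solves_on (flow q) {0..}" "\<And>t. t \<ge> 0 \<Longrightarrow> flow q t \<in> C"
proof -
  obtain x where x: "x 0 = q" "solves_on x {0..}" "x ` {0..} \<subseteq> C"
    using global_solution[OF C assms] by blast
  then have *: "flow q 0 = q \<and> solves_on (flow q) {0..}"
    unfolding flow_def by (intro someI[of "\<lambda>x. x 0 = q \<and> solves_on x {0..}"]) auto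
  then show "flow q 0 = q" "solves_on (flow q) {0..}"
    by auto
  show "flow q t \<in> C" if "t \<ge> 0" for t
  proof -
    have "flow q t = x t"
      by (rule solves_on_unique[of "flow q" t x])
         (use that x * in \<open>auto elim: solves_on_subset\<close>)
    then show ?thesis
      using x(3) that by auto
  qed
qed

lemma flow_unique:
  assumes "x 0 \<in> C" "solves_on x {0..t}" "t \<ge> 0"
  shows "x t = flow (x 0) t"
  by (rule solves_on_unique[of x t "flow (x 0)"])
     (use assms flow[OF assms(1)] in \<open>auto elim: solves_on_subset\<close>)

lemma flow_add:
  assumes "q \<in> C" "s \<ge> 0" "t \<ge> 0"
  shows "flow (flow q s) t = flow q (t + s)"
proof -
  have "solves_on (\<lambda>t. flow q (t + s)) {0..t}"
    by (rule solves_on_shift[OF flow(2)[OF assms(1)]]) (use assms in auto)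
  then show ?thesis
    using flow_unique[of "\<lambda>t. flow q (t + s)" t] flow(3)[OF assms(1)] assms by simp
qed

text \<open>The backward extension puts the forward orbit of \<open>q\<close>, including time \<open>0\<close>, into the open time
  domain of a solution through \<open>flow q t\<close>. So the orbit can also be followed backwards from
  \<open>flow q t\<close>.\<close>

lemma flow_through:
  assumes q: "q \<in> C" and t: "t \<ge> 0"
  obtains J x where "solution_through G f (flow q t) J x" "\<And>u. u \<ge> -t \<Longrightarrow> u \<in> J \<and> x u = flow q (u + t)"
proof -
  have eq: "{-e<..0} \<union> {0..} = {-e<..}" if "e > 0" for e :: real
    using that by auto
  obtain e y where y: "e > 0" "solution_through G f (flow q 0) ({-e<..0} \<union> {0..}) y"
      "\<And>t. t \<in> {0..} \<Longrightarrow> y t = flow q t"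
    by (rule solves_on_extend_backward[OF flow(2)[OF q]]) (auto simp: eq)
  have "solves_on y {-e<..}"
    using y(1,2) by (simp add: eq solution_through_iff)
  then have "solves_on (\<lambda>u. y (u + t)) {-e-t<..}"
    by (rule solves_on_shift) auto
  then have "solution_through G f (flow q t) {-e-t<..} (\<lambda>u. y (u + t))"
    unfolding solution_through_iff using y(1,3) t by (auto simp: is_interval_1)
  then show thesis
    by (rule that) (use y(1,3) t in auto)
qed

lemma flow_inj:
  assumes "p \<in> C" "q \<in> C" "t \<ge> 0" "flow p t = flow q t"
  shows "p = q"
proof -
  obtain J x where x: "solution_through G f (flow p t) J x" "\<And>u. u \<ge> -t \<Longrightarrow> u \<in> J \<and> x u = flow p (u + t)"
    using flow_through[OF assms(1,3)] by blast
  obtain J' x' where x': "solution_through G f (flow q t) J' x'" "\<And>u. u \<ge> -t \<Longrightarrow> u \<in> J' \<and> x' u = flow q (u + t)"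
    using flow_through[OF assms(2,3)] by blast
  have "flow p t \<in> G"
    using flow(3)[OF assms(1,3)] C unfolding forward_invariant_def by blast
  then have "x (-t) = x' (-t)"
    using through_unique[OF _ x(1), of J' x' "-t"] x(2)[of "-t"] x'(2)[of "-t"] x'(1) assms(4) by simp
  then show ?thesis
    using x(2)[of "-t"] x'(2)[of "-t"] flow(1) assms by simp
qed

text \<open>A map into a compact set is continuous if its graph is closed. If \<open>q n\<close> converges, a subsequence of
  the solutions from \<open>q n\<close> converges uniformly to a solution, which by uniqueness is the flow from the
  limit.\<close>

lemma continuous_on_flow:
  assumes b: "b \<ge> 0"
  shows "continuous_on ({0..b} \<times> C) (\<lambda>z. flow (snd z) (fst z))"
proof (rule continuous_from_closed_graph)
  have CG: "compact C" "C \<subseteq> G"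
    using C unfolding forward_invariant_def by auto
  then show "compact C" by simp
  show "(\<lambda>z. flow (snd z) (fst z)) \<in> {0..b} \<times> C \<rightarrow> C"
    using flow(3) by auto
  show "closed ((\<lambda>z. (z, flow (snd z) (fst z))) ` ({0..b} \<times> C))"
    unfolding closed_sequential_limits
  proof (intro allI impI, elim conjE)
    fix w l assume w: "\<forall>n. w n \<in> (\<lambda>z. (z, flow (snd z) (fst z))) ` ({0..b} \<times> C)" and l: "w \<longlonglongrightarrow> l"
    define t q where "t n = fst (fst (w n))" and "q n = snd (fst (w n))" for n
    have tq: "t n \<in> {0..b}" "q n \<in> C" "snd (w n) = flow (q n) (t n)" for n
      using spec[OF w, of n] by (auto simp: t_def q_def)
    have lim: "t \<longlonglongrightarrow> fst (fst l)" "q \<longlonglongrightarrow> snd (fst l)" "(\<lambda>n. flow (q n) (t n)) \<longlonglongrightarrow> snd l"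
      using l unfolding tq(3)[symmetric] unfolding t_def q_def by (auto intro!: tendsto_intros)
    have t0: "fst (fst l) \<in> {0..b}"
      using closed_sequentially[OF _ tq(1) lim(1)] by simp
    have q0: "snd (fst l) \<in> C"
      using closed_sequentially[OF compact_imp_closed[OF CG(1)] tq(2) lim(2)] .
    obtain r g where r: "strict_mono (r :: nat \<Rightarrow> nat)" and g: "solves_on g {0..b}"
        and ul: "uniform_limit {0..b} (\<lambda>n. flow (q (r n))) g sequentially"
    proof (rule solutions_compact[OF CG b, of "\<lambda>n. flow (q n)"])
      show "solves_on (flow (q n)) {0..b}" for n
        using flow(2)[OF tq(2)[of n]] by (auto elim: solves_on_subset)
      show "flow (q n) s \<in> C" if "s \<in> {0..b}" for n s
        using flow(3)[OF tq(2)[of n]] that by simp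
    qed
    have "(\<lambda>n. flow (q (r n)) 0) \<longlonglongrightarrow> g 0"
      using tendsto_uniform_limitI[OF ul, of 0] b by simp
    moreover have "(\<lambda>n. q (r n)) \<longlonglongrightarrow> snd (fst l)"
      using LIMSEQ_subseq_LIMSEQ[OF lim(2) r] by (simp add: o_def)
    ultimately have "g 0 = snd (fst l)"
      using flow(1)[OF tq(2)] LIMSEQ_unique by simp
    moreover have "g (fst (fst l)) = flow (g 0) (fst (fst l))"
      using flow_unique[of g "fst (fst l)"] solves_on_subset[OF g, of "{0..fst (fst l)}"]
        q0 t0 calculation by auto
    moreover have "(\<lambda>n. flow (q (r n)) (t (r n))) \<longlonglongrightarrow> g (fst (fst l))"
    proof -
      have "(\<lambda>n. t (r n)) \<longlonglongrightarrow> fst (fst l)"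
        using LIMSEQ_subseq_LIMSEQ[OF lim(1) r] by (simp add: o_def)
      from continuous_on_tendsto_compose[OF solves_on_continuous[OF g] this t0]
      have "(\<lambda>n. g (t (r n))) \<longlonglongrightarrow> g (fst (fst l))"
        using tq(1) by simp
      moreover have "(\<lambda>n. flow (q (r n)) (t (r n)) - g (t (r n))) \<longlonglongrightarrow> 0"
      proof (rule tendstoI)
        fix e :: real assume "e > 0"
        from uniform_limitD[OF ul this]
        show "\<forall>\<^sub>F n in sequentially. dist (flow (q (r n)) (t (r n)) - g (t (r n))) 0 < e"
          by eventually_elim (use tq(1) in \<open>simp add: dist_norm\<close>)
      qed
      ultimately show ?thesis
        using tendsto_add by fastforce
    qed
    moreover have "(\<lambda>n. flow (q (r n)) (t (r n))) \<longlonglongrightarrow> snd l"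
      using LIMSEQ_subseq_LIMSEQ[OF lim(3) r] by (simp add: o_def)
    ultimately have "snd l = flow (snd (fst l)) (fst (fst l))"
      using LIMSEQ_unique by metis
    then show "l \<in> (\<lambda>z. (z, flow (snd z) (fst z))) ` ({0..b} \<times> C)"
      using t0 q0 by (intro image_eqI[of _ _ "fst l"]) (auto simp: prod_eq_iff mem_Times_iff)
  qed
qed

lemma flow_tendsto:
  assumes t: "t \<longlonglongrightarrow> t0" and q: "q \<longlonglongrightarrow> q0"
    and ge: "\<And>n. t n \<ge> 0" and qC: "\<And>n. q n \<in> C"
  shows "(\<lambda>n. flow (q n) (t n)) \<longlonglongrightarrow> flow q0 t0"
proof -
  have t0: "t0 \<ge> 0"
    using LIMSEQ_le_const[OF t] ge by blast
  have "compact C"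
    using C unfolding forward_invariant_def by simp
  then have q0: "q0 \<in> C"
    using closed_sequentially[OF compact_imp_closed qC q] by blast
  have "continuous_on ({0..t0 + 1} \<times> C) (\<lambda>z. flow (snd z) (fst z))"
    using t0 by (intro continuous_on_flow) simp
  moreover have "\<forall>\<^sub>F n in sequentially. t n < t0 + 1"
    using order_tendstoD(2)[OF t] by simp
  then have "\<forall>\<^sub>F n in sequentially. (t n, q n) \<in> {0..t0 + 1} \<times> C"
    by eventually_elim (use ge qC in \<open>auto intro: less_imp_le\<close>)
  ultimately have "(\<lambda>n. flow (snd (t n, q n)) (fst (t n, q n))) \<longlonglongrightarrow> flow (snd (t0, q0)) (fst (t0, q0))"
    by (intro continuous_on_tendsto_compose[where f = "\<lambda>z. flow (snd z) (fst z)" and s = "{0..t0 + 1} \<times> C"]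
          tendsto_Pair t q) (use t0 q0 in auto)
  then show ?thesis by simp
qed

end

section \<open>Strictly trapping sets\<close>

definition strictly_trapping :: "'a set \<Rightarrow> bool" where
  "strictly_trapping C \<longleftrightarrow> compact C \<and> C \<subseteq> G \<and>
     (\<forall>q\<in>frontier C. \<forall>J x. solution_through G f q J x \<longrightarrow>
        (\<forall>\<^sub>F t in at_right 0. x t \<in> interior C) \<and> (\<forall>\<^sub>F t in at_left 0. x t \<notin> C))"

lemma solution_stays_in_interior:
  assumes "solution_through G f q J x" "q \<in> interior C"
  shows "\<forall>\<^sub>F t in at 0. t \<in> J \<and> x t \<in> interior C"
proof -
  have J: "open J" "0 \<in> J" "x 0 = q" "solves_on x J"
    using assms unfolding solution_through_iff by auto
  then have "isCont x 0"
    using solves_on_continuous continuous_on_eq_continuous_at by blast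
  then have "\<forall>\<^sub>F t in at 0. x t \<in> interior C"
    using J(3) assms(2) by (auto simp: isCont_def intro: topological_tendstoD)
  moreover have "\<forall>\<^sub>F t in at 0. t \<in> J"
    using J eventually_at_topological by blast
  ultimately show ?thesis
    by eventually_elim simp
qed

lemma strictly_trapping_imp_forward_invariant:
  assumes "strictly_trapping C"
  shows "forward_invariant C"
  unfolding forward_invariant_def
proof (intro conjI ballI allI impI)
  show "compact C" "C \<subseteq> G"
    using assms unfolding strictly_trapping_def by auto
  fix q J x assume q: "q \<in> C" and x: "solution_through G f q J x"
  show "\<forall>\<^sub>F t in at_right 0. x t \<in> C"
  proof (cases "q \<in> frontier C")
    case True
    then have "\<forall>\<^sub>F t in at_right 0. x t \<in> interior C"
      using assms x unfolding strictly_trapping_def by blast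
    then show ?thesis
      by eventually_elim (use interior_subset in blast)
  next
    case False
    then have "q \<in> interior C"
      using q closure_subset unfolding frontier_def by blast
    from solution_stays_in_interior[OF x this]
    have "\<forall>\<^sub>F t in at_right 0. t \<in> J \<and> x t \<in> interior C"
      by (simp add: eventually_at_split)
    then show ?thesis
      by eventually_elim (use interior_subset in blast)
  qed
qed

text \<open>A solution that is on the frontier at a positive time was outside \<open>C\<close> just before, which forward
  invariance excludes.\<close>

lemma flow_in_interior:
  assumes C: "strictly_trapping C" and q: "q \<in> C" and t: "t > 0"
  shows "flow q t \<in> interior C"
proof (rule ccontr)
  note inv = strictly_trapping_imp_forward_invariant[OF C]
  assume "flow q t \<notin> interior C"
  then have fr: "flow q t \<in> frontier C"
    using flow(3)[OF inv q, of t] t closure_subset unfolding frontier_def by auto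
  obtain J x where x: "solution_through G f (flow q t) J x"
      "\<And>u. u \<ge> -t \<Longrightarrow> u \<in> J \<and> x u = flow q (u + t)"
    using flow_through[OF inv q, of t] t by (metis less_imp_le)
  have "\<forall>\<^sub>F u in at_left 0. x u \<notin> C"
    using C fr x(1) unfolding strictly_trapping_def by blast
  moreover have "\<forall>\<^sub>F u in at_left 0. -t < u"
    using t by (auto simp: eventually_at_left_field intro: exI[of _ "-t"])
  ultimately have "\<forall>\<^sub>F u in at_left (0::real). False"
  proof eventually_elim
    case (elim u)
    then show False
      using x(2)[of u] flow(3)[OF inv q, of "u + t"] by simp
  qed
  then show False by simp
qed

lemma flow_stays:
  assumes C: "strictly_trapping C" and B: "strictly_trapping B" and q: "q \<in> C"
    and st: "0 \<le> s" "s < t" and sB: "flow q s \<in> B"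
  shows "flow q t \<in> interior B"
proof -
  have "flow (flow q s) (t - s) = flow q t"
    using flow_add[OF strictly_trapping_imp_forward_invariant[OF C] q, of s "t - s"] st by simp
  then show ?thesis
    using flow_in_interior[OF B sB, of "t - s"] st by simp
qed

lemma flow_backward:
  assumes C: "strictly_trapping C" and p: "p \<in> interior C"
  obtains p' u where "p' \<in> C" "u > 0" "flow p' u = p"
proof -
  have "p \<in> G"
    using C p interior_subset unfolding strictly_trapping_def by blast
  then obtain J z where z: "solution_through G f p J z"
    using unique unfolding unique_solutions_def by blast
  have "\<forall>\<^sub>F t in at_left 0. t \<in> J \<and> z t \<in> interior C"
    using solution_stays_in_interior[OF z p] by (simp add: eventually_at_split)
  moreover have "\<forall>\<^sub>F t in at_left (0::real). t < 0"
    by (simp add: eventually_at_filter)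
  ultimately have "\<forall>\<^sub>F t in at_left 0. t < 0 \<and> t \<in> J \<and> z t \<in> interior C"
    by eventually_elim simp
  then obtain v where v: "v < 0" "v \<in> J" "z v \<in> interior C"
    using eventually_happens[of _ "at_left (0::real)"] by auto
  have J: "is_interval J" "0 \<in> J" "z 0 = p" "solves_on z J"
    using z unfolding solution_through_iff by auto
  have "{v..0} \<subseteq> J"
    using J(1,2) v(2) unfolding is_interval_1 by (meson atLeastAtMost_iff subsetI)
  then have "solves_on (\<lambda>t. z (t + v)) {0..-v}"
    by (intro solves_on_shift[OF J(4)]) auto
  moreover have "z v \<in> C"
    using v(3) interior_subset by blast
  ultimately have "flow (z v) (-v) = p"
    using flow_unique[OF strictly_trapping_imp_forward_invariant[OF C], of "\<lambda>t. z (t + v)" "-v"] v(1) J(3)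
    by simp
  then show thesis
    using that[of "z v" "-v"] \<open>z v \<in> C\<close> v(1) by simp
qed

text \<open>Both sets being strict traps, the solution from a point \<open>q\<close> of \<open>frontier C\<close> is outside \<open>B\<close> before the
  time \<open>\<tau> q\<close> at which it crosses \<open>frontier B\<close>, and in \<open>interior B\<close> after it. These are open
  conditions, so \<open>\<tau>\<close> is continuous, and with it the crossing point.\<close>

lemma frontier_homeomorphic:
  assumes C: "strictly_trapping C" and B: "strictly_trapping B" and BC: "B \<subseteq> C"
    and disj: "frontier C \<inter> frontier B = {}"
    and absorbed: "\<And>q. q \<in> C \<Longrightarrow> \<exists>t\<ge>0. flow q t \<in> interior B"
  shows "frontier C homeomorphic frontier B"
proof -
  note inv = strictly_trapping_imp_forward_invariant[OF C]
  note stays = flow_stays[OF C B]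
  have cpt: "compact C" "compact B"
    using B C unfolding strictly_trapping_def by auto
  then have cl: "closed C" "closed B"
    by (auto intro: compact_imp_closed)
  have sub: "frontier C \<subseteq> C" "frontier B \<subseteq> B"
    using cl by (auto simp: frontier_def)
  have C_in: "q \<in> C" if "q \<in> frontier C" for q
    using sub(1) that by blast
  have frB: "q \<notin> interior B" if "q \<in> frontier B" for q
    using that by (simp add: frontier_def)
  have outside: "q \<notin> B" if q: "q \<in> frontier C" for q
  proof
    assume "q \<in> B"
    moreover have "q \<notin> frontier B"
      using q disj by blast
    ultimately have "q \<in> interior B"
      using closure_subset unfolding frontier_def by blast
    then have "q \<in> interior C"
      using interior_mono[OF BC] by blast
    then show False
      using q by (simp add: frontier_def)
  qed
  have "\<exists>t\<ge>0. flow q t \<in> frontier B" if q: "q \<in> frontier C" for q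
  proof -
    obtain T where T: "T \<ge> 0" "flow q T \<in> interior B"
      using absorbed[OF C_in[OF q]] by blast
    have "connected (flow q ` {0..T})"
      using solves_on_continuous[OF flow(2)[OF inv C_in[OF q]]]
      by (intro connected_continuous_image) (auto elim: continuous_on_subset)
    moreover have "flow q T \<in> flow q ` {0..T} \<inter> B"
      using T interior_subset by auto
    moreover have "flow q 0 \<in> flow q ` {0..T} - B"
      using imageI[of 0 "{0..T}" "flow q"] T(1) outside[OF q] flow(1)[OF inv C_in[OF q]] by simp
    ultimately have "flow q ` {0..T} \<inter> frontier B \<noteq> {}"
      by (intro connected_Int_frontier) blast+
    then show ?thesis by auto
  qed
  then obtain \<tau> where \<tau>: "\<And>q. q \<in> frontier C \<Longrightarrow> \<tau> q \<ge> 0 \<and> flow q (\<tau> q) \<in> frontier B"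
    by metis
  define P where "P q = flow q (\<tau> q)" for q
  have \<tau>_cont: "(\<lambda>n. \<tau> (x n)) \<longlonglongrightarrow> \<tau> a"
    if a: "a \<in> frontier C" and x: "\<And>n. x n \<in> frontier C" "x \<longlonglongrightarrow> a" for x a
  proof (rule order_tendstoI)
    have conv: "(\<lambda>n. flow (x n) t) \<longlonglongrightarrow> flow a t" if "t \<ge> 0" for t
      using flow_tendsto[OF inv tendsto_const x(2)] that C_in x(1) by blast
    show "\<forall>\<^sub>F n in sequentially. l < \<tau> (x n)" if l: "l < \<tau> a" for l
    proof (cases "l \<ge> 0")
      case True
      have "flow a l \<notin> B"
        using stays[OF C_in[OF a] True l] \<tau>[OF a] frB by blast
      then have "\<forall>\<^sub>F n in sequentially. flow (x n) l \<in> - B"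
        using conv[OF True] cl by (intro topological_tendstoD[of _ "flow a l"]) auto
      then show ?thesis
      proof eventually_elim
        case (elim n)
        show ?case
        proof (rule ccontr)
          assume "\<not> l < \<tau> (x n)"
          then have "flow (x n) l \<in> B"
            using stays[OF C_in[OF x(1)[of n]], where s = "\<tau> (x n)" and t = l] \<tau>[OF x(1)[of n]] sub interior_subset
            by (cases "l = \<tau> (x n)") auto
          then show False
            using elim by simp
        qed
      qed
    next
      case False
      have "l < \<tau> (x n)" for n
        using \<tau>[OF x(1)[of n]] False by linarith
      then show ?thesis by simp
    qed
    show "\<forall>\<^sub>F n in sequentially. \<tau> (x n) < u" if u: "\<tau> a < u" for u
    proof -
      have "flow a u \<in> interior B"
        using stays[OF C_in[OF a] _ u] \<tau>[OF a] sub by blast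
      moreover have u0: "u \<ge> 0"
        using \<tau>[OF a] u by linarith
      ultimately have "\<forall>\<^sub>F n in sequentially. flow (x n) u \<in> interior B"
        using conv[OF u0] by (intro topological_tendstoD[of _ "flow a u"]) auto
      then show ?thesis
      proof eventually_elim
        case (elim n)
        show ?case
        proof (rule ccontr)
          assume "\<not> \<tau> (x n) < u"
          then have "flow (x n) (\<tau> (x n)) \<in> interior B"
            using stays[OF C_in[OF x(1)[of n]] u0, where t = "\<tau> (x n)"] elim interior_subset
            by (cases "u = \<tau> (x n)") auto
          then show False
            using \<tau>[OF x(1)[of n]] frB by blast
        qed
      qed
    qed
  qed
  have "continuous_on (frontier C) P"
    unfolding continuous_on_sequentially
  proof (intro allI ballI impI, elim conjE)
    fix x a assume "a \<in> frontier C" "\<forall>n. x n \<in> frontier C" "x \<longlonglongrightarrow> a"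
    then show "(P \<circ> x) \<longlonglongrightarrow> P a"
      unfolding P_def o_def using \<tau>
      by (intro flow_tendsto[OF inv] \<tau>_cont) (auto intro: C_in)
  qed
  moreover have "inj_on P (frontier C)"
  proof -
    \<comment> \<open>The solution from \<open>q\<close> passes through \<open>p\<close> at time \<open>d\<close>, but it is in \<open>interior C\<close> at all
      positive times.\<close>
    have *: "p = q" if "P p = P q" "\<tau> p \<le> \<tau> q" "p \<in> frontier C" "q \<in> frontier C" for p q
    proof -
      define d where "d = \<tau> q - \<tau> p"
      have d: "d \<ge> 0"
        using that unfolding d_def by simp
      have qC: "flow q d \<in> C"
        using flow(3)[OF inv C_in d] that by blast
      have "flow (flow q d) (\<tau> p) = flow p (\<tau> p)"
        using flow_add[OF inv C_in[OF that(4)] d, of "\<tau> p"] \<tau>[OF that(3)] that(1)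
        unfolding P_def d_def by simp
      then have "flow q d = p"
        using flow_inj[OF inv qC C_in[OF that(3)]] \<tau>[OF that(3)] by blast
      moreover from this have "d = 0"
        using flow_in_interior[OF C C_in[OF that(4)], of d] d that(3) by (force simp: frontier_def)
      ultimately show "p = q"
        using flow(1)[OF inv C_in[OF that(4)]] by simp
    qed
    show ?thesis
    proof (rule inj_onI)
      fix p q assume "p \<in> frontier C" "q \<in> frontier C" "P p = P q"
      then show "p = q"
        using *[of p q] *[of q p] by (cases "\<tau> p \<le> \<tau> q") auto
    qed
  qed
  moreover have "P ` frontier C = frontier B"
  proof
    show "P ` frontier C \<subseteq> frontier B"
      using \<tau> unfolding P_def by blast
    show "frontier B \<subseteq> P ` frontier C"
    proof
      fix r assume r: "r \<in> frontier B"
      \<comment> \<open>The set of times for which \<open>r\<close> can be followed backwards inside \<open>C\<close>. Its maximum is reached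
        at a point of \<open>frontier C\<close>.\<close>
      define E where "E = {s. 0 \<le> s \<and> (\<exists>p\<in>C. flow p s = r)}"
      have rC: "r \<in> C"
        using r sub BC by blast
      then have E0: "0 \<in> E"
        using flow(1)[OF inv rC] unfolding E_def by auto
      \<comment> \<open>Starting points at unbounded times would accumulate at a point that is absorbed by \<open>interior B\<close>
        at some time \<open>T\<close>. Solutions from points near it would be in \<open>interior B\<close> from time \<open>T\<close> on and
        could not reach \<open>r\<close> later.\<close>
      have bdd: "bdd_above E"
      proof (rule ccontr)
        assume "\<not> bdd_above E"
        then have "\<forall>n. \<exists>s\<in>E. real n < s"
          unfolding bdd_above_def by (meson not_le)
        then obtain s where s: "\<And>n. s n \<in> E" "\<And>n. real n < s n"
          by metis
        have "\<forall>n. \<exists>p\<in>C. flow p (s n) = r"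
          using s(1) unfolding E_def by blast
        then obtain p where p: "\<And>n. p n \<in> C" "\<And>n. flow (p n) (s n) = r"
          by metis
        obtain p0 k where k: "p0 \<in> C" "strict_mono (k :: nat \<Rightarrow> nat)" "(p \<circ> k) \<longlonglongrightarrow> p0"
          using cpt(1)[unfolded compact_def, rule_format, of p] p(1) by blast
        obtain T where T: "T \<ge> 0" "flow p0 T \<in> interior B"
          using absorbed[OF k(1)] by blast
        have "(\<lambda>n. flow ((p \<circ> k) n) T) \<longlonglongrightarrow> flow p0 T"
          using T(1) p(1) by (intro flow_tendsto[OF inv tendsto_const k(3)]) auto
        then have "\<forall>\<^sub>F n in sequentially. flow ((p \<circ> k) n) T \<in> interior B"
          using T(2) by (intro topological_tendstoD[of _ "flow p0 T"]) auto
        moreover have "\<forall>\<^sub>F n in sequentially. T \<le> real n"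
          by (rule eventually_sequentiallyI[of "nat \<lceil>T\<rceil>"]) linarith
        ultimately have "\<forall>\<^sub>F n in sequentially. r \<in> interior B"
        proof eventually_elim
          case (elim n)
          have "real n \<le> real (k n)"
            using seq_suble[OF k(2), of n] by simp
          then have "T < s (k n)"
            using elim(2) s(2)[of "k n"] by linarith
          then show ?case
            using stays[OF p(1)[of "k n"] T(1)] elim(1) interior_subset p(2)[of "k n"] by fastforce
        qed
        then show False
          using frB[OF r] by simp
      qed
      define m where "m = Sup E"
      have "m \<in> closure E"
        unfolding m_def using E0 bdd by (intro closure_contains_Sup) auto
      then obtain s where s: "\<And>n. s n \<in> E" "s \<longlonglongrightarrow> m"
        unfolding closure_sequential by blast
      have "\<forall>n. \<exists>p\<in>C. flow p (s n) = r"
        using s(1) unfolding E_def by blast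
      then obtain p where p: "\<And>n. p n \<in> C" "\<And>n. flow (p n) (s n) = r"
        by metis
      obtain p0 k where k: "p0 \<in> C" "strict_mono (k :: nat \<Rightarrow> nat)" "(p \<circ> k) \<longlonglongrightarrow> p0"
        using cpt(1)[unfolded compact_def, rule_format, of p] p(1) by blast
      have "(\<lambda>n. flow ((p \<circ> k) n) ((s \<circ> k) n)) \<longlonglongrightarrow> flow p0 m"
        using p(1) s(1) by (intro flow_tendsto[OF inv LIMSEQ_subseq_LIMSEQ[OF s(2) k(2)] k(3)]) (auto simp: E_def)
      then have p0: "flow p0 m = r"
        using p(2) by (simp add: LIMSEQ_const_iff)
      have m: "m \<ge> 0"
        unfolding m_def using E0 bdd by (rule cSup_upper)
      have "p0 \<notin> interior C"
      proof
        assume "p0 \<in> interior C"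
        then obtain p' u where p': "p' \<in> C" "u > 0" "flow p' u = p0"
          using flow_backward[OF C] by blast
        then have "flow p' (m + u) = r"
          using flow_add[OF inv p'(1), of u m] m p0 by simp
        then have "m + u \<in> E"
          using p' m unfolding E_def by auto
        then have "m + u \<le> m"
          unfolding m_def using bdd by (rule cSup_upper)
        then show False
          using p'(2) by simp
      qed
      then have fr: "p0 \<in> frontier C"
        using k(1) closure_subset unfolding frontier_def by blast
      have "\<tau> p0 = m"
      proof (rule ccontr)
        assume "\<tau> p0 \<noteq> m"
        then have "flow p0 (max (\<tau> p0) m) \<in> interior B"
          using stays[OF k(1), where s = "\<tau> p0" and t = m]
            stays[OF k(1) m, where t = "\<tau> p0"] \<tau>[OF fr] p0 r sub
          by (auto simp: max_def)
        then show False
          using \<tau>[OF fr] p0 r frB by (auto simp: max_def split: if_splits)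
      qed
      then show "r \<in> P ` frontier C"
        using fr p0 unfolding P_def by blast
    qed
  qed
  ultimately show ?thesis
    using compact_frontier[OF cpt(1)] homeomorphic_compact by blast
qed

lemma solution_through_eq_flow:
  assumes C: "forward_invariant C" and q: "q \<in> C"
    and x: "solution_through G f q J x" and t: "t \<in> J" "t \<ge> 0"
  shows "x t = flow q t"
  using flow_unique[OF C _ solution_through_forward[OF x t(1)] t(2)] x q
  unfolding solution_through_iff by simp

lemma forward_complete:
  assumes C: "forward_invariant C" and q: "q \<in> C"
  shows "\<exists>J x. solution_through G f q J x \<and> {0..} \<subseteq> J"
proof -
  obtain J x where "solution_through G f (flow q 0) J x" "\<And>u. u \<ge> -0 \<Longrightarrow> u \<in> J \<and> x u = flow q (u + 0)"
    using flow_through[OF C q order_refl] by blast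
  then show ?thesis
    using flow(1)[OF C q] by auto
qed

section \<open>Stability and attraction\<close>

lemma lyapunov_stable_if_forward_invariant_nbhds:
  assumes "\<And>\<epsilon>. \<epsilon> > 0 \<Longrightarrow> \<exists>C. forward_invariant C \<and> p \<in> interior C \<and> C \<subseteq> ball p \<epsilon>"
  shows "lyapunov_stable G f p"
  unfolding lyapunov_stable_def
proof (intro allI impI)
  fix \<epsilon> :: real assume "\<epsilon> > 0"
  then obtain C where C: "forward_invariant C" "p \<in> interior C" "C \<subseteq> ball p \<epsilon>"
    using assms by blast
  obtain \<delta> where \<delta>: "\<delta> > 0" "ball p \<delta> \<subseteq> C"
    using C(2) unfolding mem_interior by blast
  show "\<exists>\<delta>>0. \<forall>q\<in>G. dist q p < \<delta> \<longrightarrow>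
      (\<exists>J x. solution_through G f q J x \<and> {0..} \<subseteq> J) \<and>
      (\<forall>J x. solution_through G f q J x \<longrightarrow> (\<forall>t\<in>J. 0 \<le> t \<longrightarrow> dist (x t) p < \<epsilon>))"
  proof (intro exI[of _ \<delta>] conjI ballI impI allI)
    fix q assume "q \<in> G" "dist q p < \<delta>"
    then have q: "q \<in> C"
      using \<delta>(2) by (auto simp: dist_commute)
    show "\<exists>J x. solution_through G f q J x \<and> {0..} \<subseteq> J"
      by (rule forward_complete[OF C(1) q])
    fix J x t assume x: "solution_through G f q J x" and t: "t \<in> J" "0 \<le> t"
    have "x t \<in> C"
      using solution_through_eq_flow[OF C(1) q x t] flow(3)[OF C(1) q t(2)] by simp
    then show "dist (x t) p < \<epsilon>"
      using C(3) by (auto simp: dist_commute)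
  qed (rule \<delta>(1))
qed

lemma attractive_imp_absorbed:
  assumes C: "forward_invariant C" and attr: "\<And>q. q \<in> C \<Longrightarrow> (flow q \<longlongrightarrow> p) at_top"
    and p: "p \<in> interior B" and q: "q \<in> C"
  shows "\<exists>t\<ge>0. flow q t \<in> interior B"
proof -
  have "\<forall>\<^sub>F t in at_top. flow q t \<in> interior B"
    using attr[OF q] p by (intro topological_tendstoD[of _ p]) auto
  moreover have "\<forall>\<^sub>F t in at_top. (0::real) \<le> t"
    by (rule eventually_ge_at_top)
  ultimately have "\<forall>\<^sub>F t in at_top. 0 \<le> t \<and> flow q t \<in> interior B"
    by eventually_elim simp
  then show ?thesis
    using eventually_happens[of _ "at_top :: real filter"] by auto
qed

end

text \<open>Otherwise the sets \<open>K i - U\<close> would be a decreasing sequence of nonempty compact sets, with a common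
  point different from the origin.\<close>

lemma convergent_hypersurfaces_subset_open:
  assumes "convergent_hypersurfaces G H K" "open U" "0 \<in> U"
  shows "\<exists>m. \<forall>i\<ge>m. K i \<subseteq> U"
proof (rule ccontr)
  have K: "\<And>i. compact (K i)" "(\<Inter>i. K i) = {0}" "\<And>i j. i < j \<Longrightarrow> K j \<subseteq> K i"
    using assms(1) unfolding convergent_hypersurfaces_def bounds_around_origin_def by auto
  have mono: "K j \<subseteq> K i" if "i \<le> j" for i j
    using K(3)[of i j] that by (cases "i = j") auto
  assume "\<not> (\<exists>m. \<forall>i\<ge>m. K i \<subseteq> U)"
  then have "K m - U \<noteq> {}" for m
    using mono by blast
  then have "(\<Inter>i. K i - U) \<noteq> {}"
    using K(1) mono by (intro compact_nest compact_diff assms(2)) blast+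
  then show False
    using K(2) assms(3) by blast
qed

theorem theorem4p1:
  fixes G :: "(real ^ 'n) set"
    and f :: "real ^ 'n \<Rightarrow> real ^ 'n"
    and H K :: "nat \<Rightarrow> (real ^ 'n) set"
    and N :: "nat \<Rightarrow> real ^ 'n \<Rightarrow> real ^ 'n"
  assumes neighborhood: "0 \<in> interior G"
    and continuous: "continuous_on G f"
    and unique: "unique_solutions G f"
    and equilibrium: "isolated_equilibrium G f 0"
    and hypersurfaces: "convergent_hypersurfaces G H K"
    and different: "different_hypersurfaces H"
    and normal: "\<And>i x. x \<in> H i \<Longrightarrow> inward_unit_normal (H i) (K i) x (N i x)"
    and inward: "\<And>i x. x \<in> H i \<Longrightarrow> N i x \<bullet> f x > 0"
  shows "lyapunov_stable G f 0 \<and> \<not> asymptotically_stable G f 0"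
proof -
  interpret autonomous_ode G f
    using continuous unique by unfold_locales
  have H: "smooth_submanifold (CARD('n) - 1) (H i)" "0 \<notin> H i" and K: "compact (K i)" "0 \<in> K i" "frontier (K i) = H i"
    and disj: "i \<noteq> j \<Longrightarrow> H i \<inter> H j = {}" and nested: "i < j \<Longrightarrow> K j \<subseteq> K i" for i j
    using hypersurfaces unfolding convergent_hypersurfaces_def restricts_origin_def bounds_around_origin_def
    by auto
  have zero_interior: "0 \<in> interior (K i)" for i
    using H(2)[of i] K(2,3)[of i] closure_subset unfolding frontier_def by blast
  \<comment> \<open>The sets \<open>K i\<close> need not lie in \<open>G\<close>, but all but finitely many do, since \<open>G\<close> is a
    neighbourhood of the origin.\<close>
  have trapping: "strictly_trapping (K i)" if "K i \<subseteq> G" for i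
    unfolding strictly_trapping_def
  proof (intro conjI ballI allI impI)
    fix q J x assume q: "q \<in> frontier (K i)" and x: "solution_through G f q J x"
    then have x0: "x 0 = q" "(x has_vector_derivative f q) (at 0)"
      unfolding solution_through_def by auto
    have qH: "q \<in> H i"
      using q K(3) by simp
    note cross = crosses_inward[OF _ compact_imp_closed[OF K(1)] K(3), of i x 0 "N i q" "f q"]
    show "\<forall>\<^sub>F t in at_right 0. x t \<in> interior (K i)" "\<forall>\<^sub>F t in at_left 0. x t \<notin> K i"
      using cross H(1) x0 qH normal[OF qH] inward[OF qH] by auto
  qed (use K(1) that in auto)
  note small = convergent_hypersurfaces_subset_open[OF hypersurfaces]
  have "lyapunov_stable G f 0"
  proof (rule lyapunov_stable_if_forward_invariant_nbhds)
    fix \<epsilon> :: real assume "\<epsilon> > 0"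
    then obtain m where "\<forall>i\<ge>m. K i \<subseteq> ball 0 \<epsilon> \<inter> interior G"
      using small[of "ball 0 \<epsilon> \<inter> interior G"] neighborhood by auto
    then have "K m \<subseteq> ball 0 \<epsilon>" "K m \<subseteq> G"
      using interior_subset by blast+
    then show "\<exists>C. forward_invariant C \<and> 0 \<in> interior C \<and> C \<subseteq> ball 0 \<epsilon>"
      using strictly_trapping_imp_forward_invariant[OF trapping] zero_interior by blast
  qed
  moreover have "\<not> attractive G f 0"
  proof
    assume "attractive G f 0"
    then obtain \<delta> where \<delta>: "\<delta> > 0" "\<And>q J x. q \<in> G \<Longrightarrow> dist q 0 < \<delta> \<Longrightarrow> solution_through G f q J x \<Longrightarrow>
        {0..} \<subseteq> J \<Longrightarrow> (x \<longlongrightarrow> 0) at_top"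
      unfolding attractive_def by blast
    obtain m where m: "\<forall>i\<ge>m. K i \<subseteq> ball 0 \<delta> \<inter> interior G"
      using small[of "ball 0 \<delta> \<inter> interior G"] neighborhood \<delta>(1) by auto
    obtain k l where kl: "k > l" "l > m" "\<not> H k homeomorphic H l"
      using different unfolding different_hypersurfaces_def by blast
    have sub: "K l \<subseteq> ball 0 \<delta>" "K l \<subseteq> G" "K k \<subseteq> G"
      using m kl(1,2) interior_subset[of G] by (meson dual_order.trans le_inf_iff less_imp_le)+
    note inv = strictly_trapping_imp_forward_invariant[OF trapping[OF sub(2)]]
    have attr: "(flow q \<longlongrightarrow> 0) at_top" if q: "q \<in> K l" for q
    proof -
      obtain J x where x: "solution_through G f q J x" "{0..} \<subseteq> J"
        using forward_complete[OF inv q] by blast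
      then have "(x \<longlongrightarrow> 0) at_top"
        using \<delta>(2)[of q] q sub by (auto simp: subset_iff)
      moreover have "\<forall>\<^sub>F t in at_top. x t = flow q t"
        using eventually_ge_at_top[of "0::real"]
        by eventually_elim (use solution_through_eq_flow[OF inv q x(1)] x(2) in auto)
      ultimately show ?thesis
        using tendsto_cong by blast
    qed
    have "frontier (K l) homeomorphic frontier (K k)"
    proof (rule frontier_homeomorphic[OF trapping[OF sub(2)] trapping[OF sub(3)] nested[OF kl(1)]])
      show "frontier (K l) \<inter> frontier (K k) = {}"
        using disj[of l k] kl(1) K(3) by simp
      show "\<exists>t\<ge>0. flow q t \<in> interior (K k)" if "q \<in> K l" for q
        using attractive_imp_absorbed[OF inv attr zero_interior that] .
    qed
    then show False
      using kl(3) K(3) homeomorphic_sym by metis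
  qed
  ultimately show ?thesis
    unfolding asymptotically_stable_def by blast
qed

end
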